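(* Let $n,q\ge2$ be coprime integers and let $$\mathcal{H}(n,q):=|\{(d_1,d_2)\in\mathcal{D}_n^2:\ d_1\equiv d_2\pmod q\}|=\frac{1}{\phi(q)}\sum_{\chi \bmod q}\Bigl|\sum_{d\mid n}\chi(d)\Bigr|^2 .$$ Then, with $\eta:=\frac{\log q}{\log n}$, $$\mathcal{H}(n,q)\ll\bigl(\tau(n)+\tau(n)^{2-4\eta}\bigr)V(n)(\log\tau(n))^{3/2},$$ with an absolute implied constant.
   Context: $\mathcal{D}_n$ is the set of positive divisors of $n$, $\tau(n)=|\mathcal{D}_n|$, $\phi$ is Euler's totient function, the sum over $\chi$ runs over Dirichlet characters modulo $q$, and $V(n):=\max_{p^v\| n}v$. *)

theory Defs
  imports Complex_Main "HOL-Computational_Algebra.Primes" "HOL-Number_Theory.Number_Theory"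
begin

definition divisors :: "nat \<Rightarrow> nat set" where
  "divisors n = {d. 0 < d \<and> d dvd n}"

definition tau :: "nat \<Rightarrow> nat" where
  "tau n = card (divisors n)"

text \<open>
  The largest exponent in the prime factorization. The set of exponents is empty for
  \<open>n \<le> 1\<close>, where the value is unspecified.
\<close>
definition max_exponent :: "nat \<Rightarrow> nat" where
  "max_exponent n = Max ((\<lambda>p. multiplicity p n) ` prime_factors n)"

text \<open>
  The condition \<open>\<chi> 1 = 1\<close> is not listed: it follows from multiplicativity and
  \<open>\<chi> 1 \<noteq> 0\<close>. For \<open>q > 0\<close> a periodic function on the naturals is the same as
  a function on the residue classes modulo \<open>q\<close>.  In that case the set is finite,
  since nonzero values are roots of unity of order dividing \<open>totient q\<close>, so sums over it are genuine.
\<close>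
definition dirichlet_characters :: "nat \<Rightarrow> (nat \<Rightarrow> complex) set" where
  "dirichlet_characters q =
     {\<chi>. (\<forall>a b. \<chi> (a * b) = \<chi> a * \<chi> b) \<and>
          (\<forall>a. \<chi> (a + q) = \<chi> a) \<and>
          (\<forall>a. \<chi> a \<noteq> 0 \<longleftrightarrow> coprime a q)}"

definition congruent_divisor_pairs :: "nat \<Rightarrow> nat \<Rightarrow> nat" where
  "congruent_divisor_pairs n q =
     card {(d1, d2). d1 \<in> divisors n \<and> d2 \<in> divisors n \<and> [d1 = d2] (mod q)}"

end

theory Submission imports Defs begin

text \<open>
  The identity is orthogonality of characters; characters separating residues are obtained by
  extending a character of a subgroup of the units one generator at a time.

  For the bound, let \<open>S\<close> be a set of \<open>k\<close> divisors of \<open>n\<close> in one residue class modulo \<open>q\<close>. For distinct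
  \<open>x, y \<in> S\<close> the number \<open>x - y\<close> is divisible by \<open>q * gcd x y\<close>. Multiplying over all pairs and
  bounding the product of the gcds from below prime power by prime power gives, when \<open>S\<close> lies in a
  window \<open>n powr \<beta> \<le> x \<le> n powr (\<beta> + \<delta>)\<close> and \<open>q \<ge> n powr (1/4 + 2 * \<delta>)\<close>, that
  \<open>k = O(1 / (\<delta> + (\<beta> - 1/2)^2))\<close>. Summing over the \<open>1/\<delta>\<close> windows bounds a residue class by
  \<open>O(\<delta> powr (-3/2))\<close>. With \<open>\<delta>\<close> of order \<open>1 / ln (tau n)\<close> this settles all \<open>q\<close> slightly above \<open>n powr (1/4)\<close>.

  For smaller \<open>q\<close> write \<open>n = m * k\<close> with \<open>m, k\<close> coprime, so that the character sums factor and the count for \<open>n\<close>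
  is at most \<open>tau k ^ 2\<close> times the count for \<open>m\<close>. A greedy choice of the prime powers of \<open>m\<close> makes \<open>m\<close> slightly smaller than
  \<open>q ^ 4\<close> while \<open>tau m\<close> is at least \<open>tau n powr (4 * \<eta>)\<close> up to a factor \<open>O(max_exponent n)\<close>, the
  loss coming from the one prime power that no longer fits.
\<close>

section \<open>Dirichlet characters\<close>

text \<open>
  A character of the subgroup of units modulo \<open>q\<close> whose representatives form \<open>H\<close>. Closure under
  inverses is automatic because units have finite order.
\<close>
definition partial_character :: "nat \<Rightarrow> nat set \<Rightarrow> (nat \<Rightarrow> complex) \<Rightarrow> bool" where
  "partial_character q H \<chi> \<longleftrightarrow>
     H \<subseteq> {a. coprime a q} \<and> 1 \<in> H \<and>
     (\<forall>a\<in>H. \<forall>b\<in>H. a * b \<in> H \<and> \<chi> (a * b) = \<chi> a * \<chi> b) \<and>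
     (\<forall>a\<in>H. \<forall>b. [a = b] (mod q) \<longrightarrow> b \<in> H \<and> \<chi> b = \<chi> a) \<and>
     (\<forall>a\<in>H. \<chi> a \<noteq> 0)"

lemma partial_characterD:
  assumes "partial_character q H \<chi>"
  shows "a \<in> H \<Longrightarrow> coprime a q" "1 \<in> H"
    "a \<in> H \<Longrightarrow> b \<in> H \<Longrightarrow> a * b \<in> H"
    "a \<in> H \<Longrightarrow> b \<in> H \<Longrightarrow> \<chi> (a * b) = \<chi> a * \<chi> b"
    "a \<in> H \<Longrightarrow> [a = b] (mod q) \<Longrightarrow> b \<in> H"
    "a \<in> H \<Longrightarrow> [a = b] (mod q) \<Longrightarrow> \<chi> b = \<chi> a"
    "a \<in> H \<Longrightarrow> \<chi> a \<noteq> 0"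
  using assms unfolding partial_character_def by blast+

lemma partial_character_one: "partial_character q H \<chi> \<Longrightarrow> \<chi> 1 = 1"
  using partial_characterD(4)[of q H \<chi> 1 1] partial_characterD(2)[of q H \<chi>]
    partial_characterD(7)[of q H \<chi> 1] by simp

lemma partial_character_power:
  assumes "partial_character q H \<chi>" "a \<in> H"
  shows "a ^ m \<in> H" "\<chi> (a ^ m) = \<chi> a ^ m"
proof -
  have "a ^ m \<in> H \<and> \<chi> (a ^ m) = \<chi> a ^ m"
  proof (induction m)
    case 0
    show ?case using partial_characterD(2)[OF assms(1)] partial_character_one[OF assms(1)] by simp
  next
    case (Suc m)
    then show ?case using partial_characterD(3,4)[OF assms(1,2)] by simp
  qed
  then show "a ^ m \<in> H" "\<chi> (a ^ m) = \<chi> a ^ m" by auto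
qed

text \<open>By Euler's theorem \<open>a ^ (totient q - 1)\<close> inverts \<open>a\<close> modulo
  \<open>q\<close>, and as a power of \<open>a\<close> it lies in \<open>H\<close>. Multiplying
  \<open>a * b\<close> by it gives an element of \<open>H\<close> congruent to
  \<open>b\<close>.\<close>

lemma partial_character_cancel:
  assumes pc: "partial_character q H \<chi>" and q: "q > 0" and a: "a \<in> H" and ab: "a * b \<in> H"
  shows "b \<in> H"
proof -
  have "[a ^ totient q = 1] (mod q)"
    using euler_theorem partial_characterD(1)[OF pc a] by blast
  moreover have "a ^ totient q = a ^ (totient q - 1) * a"
    using q by (metis Suc_diff_1 power_Suc2 totient_gt_0_iff)
  ultimately have "[a ^ (totient q - 1) * (a * b) = b] (mod q)"
    by (metis cong_scalar_right mult.assoc mult_1)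
  moreover have "a ^ (totient q - 1) * (a * b) \<in> H"
    using partial_characterD(3)[OF pc] partial_character_power(1)[OF pc a] ab by blast
  ultimately show ?thesis using partial_characterD(5)[OF pc] by blast
qed

text \<open>The larger group consists of the residues \<open>h * x ^ i\<close>, and the value there
  is forced to be \<open>\<chi> h * z ^ i\<close>. This is well defined precisely because
  \<open>z\<close> reproduces \<open>\<chi>\<close> on every power of \<open>x\<close> that already
  lies in \<open>H\<close>. Leaving \<open>z\<close> free allows the value at \<open>x\<close> to be
  prescribed.\<close>

lemma partial_character_adjoin:
  assumes pc: "partial_character q H \<chi>" and q: "q > 0" and x: "coprime x q"
    and z: "z \<noteq> 0" "\<And>m. x ^ m \<in> H \<Longrightarrow> z ^ m = \<chi> (x ^ m)"
  shows "\<exists>H' \<chi>'. partial_character q H' \<chi>' \<and> H \<subseteq> H' \<and> x \<in> H' \<and> \<chi>' x = z \<and>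
           (\<forall>a\<in>H. \<chi>' a = \<chi> a)"
proof -
  define R where "R = (\<lambda>y h i. h \<in> H \<and> [y = h * x ^ i] (mod q))"
  define H' where "H' = {y. \<exists>h i. R y h i}"
  define \<chi>' where "\<chi>' = (\<lambda>y. SOME c. \<exists>h i. R y h i \<and> c = \<chi> h * z ^ i)"
  \<comment> \<open>Two representations of one residue are compared by cancelling the unit
    \<open>x ^ i\<close> and then \<open>h'\<close>. This puts \<open>x ^ (j - i)\<close> into
    \<open>H\<close>, where the hypothesis on \<open>z\<close> applies.\<close>
  have unique_le: "\<chi> h * z ^ i = \<chi> h' * z ^ j"
    if "R y h i" "R y h' j" "i \<le> j" for y h i h' j
  proof -
    have "[h * x ^ i = (h' * x ^ (j - i)) * x ^ i] (mod q)"
      using that unfolding R_def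
      by (metis cong_sym cong_trans le_add_diff_inverse2 mult.assoc power_add)
    then have c: "[h = h' * x ^ (j - i)] (mod q)"
      using x cong_mult_rcancel_nat coprime_power_left_iff by blast
    then have m: "h' * x ^ (j - i) \<in> H" and e: "\<chi> (h' * x ^ (j - i)) = \<chi> h"
      using that partial_characterD(5,6)[OF pc] unfolding R_def by blast+
    have h': "h' \<in> H" using that R_def by blast
    have xH: "x ^ (j - i) \<in> H" using partial_character_cancel[OF pc q h' m] .
    have "\<chi> h = \<chi> h' * z ^ (j - i)"
      using e partial_characterD(4)[OF pc h' xH] z(2)[OF xH] by simp
    then show ?thesis using that(3) by (simp add: power_add[symmetric])
  qed
  have val: "\<chi>' y = \<chi> h * z ^ i" if "R y h i" for y h i
    unfolding \<chi>'_def
  proof (rule some_equality)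
    show "\<exists>h' i'. R y h' i' \<and> \<chi> h * z ^ i = \<chi> h' * z ^ i'" using that by blast
  next
    fix c assume "\<exists>h' i'. R y h' i' \<and> c = \<chi> h' * z ^ i'"
    then show "c = \<chi> h * z ^ i" using that unique_le by (metis nle_le)
  qed
  have Rmult: "R (y * y') (h * h') (i + i')" if "R y h i" "R y' h' i'" for y y' h h' i i'
  proof -
    have "[y * y' = (h * x ^ i) * (h' * x ^ i')] (mod q)"
      using that unfolding R_def by (blast intro: cong_mult)
    then show ?thesis using that partial_characterD(3)[OF pc] unfolding R_def
      by (simp add: power_add mult_ac)
  qed
  have Rcong: "R y' h i" if "R y h i" "[y = y'] (mod q)" for y y' h i
    using that unfolding R_def by (metis cong_sym cong_trans)
  have RH: "R y y 0" if "y \<in> H" for y using that unfolding R_def by simp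
  have Rx: "R x 1 1" using partial_characterD(2)[OF pc] unfolding R_def by simp
  have "partial_character q H' \<chi>'"
    unfolding partial_character_def
  proof (intro conjI ballI allI impI)
    show "H' \<subseteq> {a. coprime a q}"
    proof
      fix y assume "y \<in> H'"
      then obtain h i where "R y h i" unfolding H'_def by blast
      then have "coprime (h * x ^ i) q" "[y = h * x ^ i] (mod q)"
        using x partial_characterD(1)[OF pc] unfolding R_def by auto
      then show "y \<in> {a. coprime a q}" by (metis cong_imp_coprime cong_sym mem_Collect_eq)
    qed
    show "1 \<in> H'" using RH partial_characterD(2)[OF pc] unfolding H'_def by blast
  next
    fix a b assume "a \<in> H'" "b \<in> H'"
    then obtain h i h' i' where r: "R a h i" "R b h' i'" unfolding H'_def by blast
    note r' = Rmult[OF r]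
    show "a * b \<in> H'" using r' unfolding H'_def by blast
    have "h \<in> H" "h' \<in> H" using r unfolding R_def by auto
    then show "\<chi>' (a * b) = \<chi>' a * \<chi>' b"
      using val[OF r(1)] val[OF r(2)] val[OF r'] partial_characterD(4)[OF pc]
      by (simp add: power_add mult_ac)
  next
    fix a b assume "a \<in> H'" and c: "[a = b] (mod q)"
    then obtain h i where r: "R a h i" unfolding H'_def by blast
    note r' = Rcong[OF r c]
    show "b \<in> H'" using r' unfolding H'_def by blast
    show "\<chi>' b = \<chi>' a" using val[OF r] val[OF r'] by simp
  next
    fix a assume "a \<in> H'"
    then obtain h i where r: "R a h i" unfolding H'_def by blast
    then have "h \<in> H" unfolding R_def by auto
    then show "\<chi>' a \<noteq> 0" using val[OF r] z(1) partial_characterD(7)[OF pc] by simp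
  qed
  moreover have "H \<subseteq> H'" using RH unfolding H'_def by blast
  moreover have "x \<in> H'" using Rx unfolding H'_def by blast
  moreover have "\<chi>' x = z" using val[OF Rx] partial_character_one[OF pc] by simp
  moreover have "\<forall>a\<in>H. \<chi>' a = \<chi> a" using val[OF RH] by simp
  ultimately show ?thesis by blast
qed

text \<open>With \<open>r\<close> the order of \<open>x\<close> modulo \<open>H\<close>, the powers
  of \<open>x\<close> in \<open>H\<close> are powers of \<open>x ^ r\<close>. Hence any complex
  \<open>r\<close>-th root of \<open>\<chi> (x ^ r)\<close> is an admissible value at
  \<open>x\<close>.\<close>

lemma partial_character_extend:
  assumes pc: "partial_character q H \<chi>" and q: "q > 0" and x: "coprime x q"
  shows "\<exists>H' \<chi>'. partial_character q H' \<chi>' \<and> H \<subseteq> H' \<and> x \<in> H' \<and> (\<forall>a\<in>H. \<chi>' a = \<chi> a)"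
proof -
  define r where "r = (LEAST r. r > 0 \<and> x ^ r \<in> H)"
  have "x ^ totient q \<in> H"
    using partial_characterD(5)[OF pc partial_characterD(2)[OF pc] cong_sym[OF euler_theorem[OF x]]] .
  then have "totient q > 0 \<and> x ^ totient q \<in> H" using q by simp
  then have r: "r > 0 \<and> x ^ r \<in> H" unfolding r_def by (rule LeastI)
  note r = conjunct1[OF r] conjunct2[OF r]
  \<comment> \<open>Division with remainder: the power of \<open>x\<close> with exponent
    \<open>m mod r\<close> lies in \<open>H\<close> by cancellation, so minimality of
    \<open>r\<close> makes the remainder zero.\<close>
  have dvd: "r dvd m" if m: "x ^ m \<in> H" for m
  proof -
    have "x ^ m = (x ^ r) ^ (m div r) * x ^ (m mod r)"
      by (simp flip: power_add power_mult)
    then have "(x ^ r) ^ (m div r) * x ^ (m mod r) \<in> H" using m by simp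
    then have "x ^ (m mod r) \<in> H"
      using partial_character_cancel[OF pc q partial_character_power(1)[OF pc r(2)]] by blast
    moreover have "m mod r < r" using r(1) by simp
    ultimately have "\<not> m mod r > 0"
      using not_less_Least[of "m mod r" "\<lambda>r. r > 0 \<and> x ^ r \<in> H", folded r_def] by simp
    then show ?thesis by auto
  qed
  have nz: "\<chi> (x ^ r) \<noteq> 0" using partial_characterD(7)[OF pc r(2)] .
  have "card {z. z ^ r = \<chi> (x ^ r)} \<noteq> 0" using card_nth_roots[OF nz r(1)] r(1) by simp
  then have "{z. z ^ r = \<chi> (x ^ r)} \<noteq> {}" by (intro notI) simp
  then obtain z where z: "z ^ r = \<chi> (x ^ r)" by blast
  have z0: "z \<noteq> 0" using z nz r(1) by (auto simp: power_0_left)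
  have zm: "z ^ m = \<chi> (x ^ m)" if m: "x ^ m \<in> H" for m
  proof -
    obtain k where "m = r * k" using dvd[OF m] by blast
    then show ?thesis
      using z partial_character_power(2)[OF pc r(2)] by (simp add: power_mult)
  qed
  show ?thesis using partial_character_adjoin[OF pc q x z0 zm] by blast
qed

lemma partial_character_extend_finite:
  assumes "finite F" and "F \<subseteq> {a. coprime a q}" and "q > 0" and "partial_character q H \<chi>"
  shows "\<exists>H' \<chi>'. partial_character q H' \<chi>' \<and> H \<subseteq> H' \<and> F \<subseteq> H' \<and> (\<forall>a\<in>H. \<chi>' a = \<chi> a)"
  using assms
proof (induction F rule: finite_induct)
  case empty
  then show ?case by blast
next
  case (insert x F)
  have "F \<subseteq> {a. coprime a q}" using insert.prems(1) by simp
  from insert.IH[OF this insert.prems(2,3)]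
  obtain H1 \<chi>1 where 1: "partial_character q H1 \<chi>1" "H \<subseteq> H1" "F \<subseteq> H1" "\<forall>a\<in>H. \<chi>1 a = \<chi> a"
    by blast
  have x: "coprime x q" using insert.prems(1) by simp
  obtain H2 \<chi>2 where 2: "partial_character q H2 \<chi>2" "H1 \<subseteq> H2" "x \<in> H2" "\<forall>a\<in>H1. \<chi>2 a = \<chi>1 a"
    using partial_character_extend[OF 1(1) insert.prems(2) x] by blast
  have "\<forall>a\<in>H. \<chi>2 a = \<chi> a" using 1 2 by (metis subsetD)
  then show ?case using 1 2 by (intro exI[of _ H2] exI[of _ \<chi>2]) auto
qed

text \<open>Adjoining the finitely many reduced residues below \<open>q\<close> makes the domain
  contain all units, by closure under congruence. Extension by zero to the non-units then gives a
  Dirichlet character.\<close>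

lemma partial_character_extend_dirichlet:
  assumes pc: "partial_character q H \<chi>" and q: "q > 0"
  shows "\<exists>\<psi>\<in>dirichlet_characters q. \<forall>a\<in>H. \<psi> a = \<chi> a"
proof -
  have "\<exists>H' \<chi>'. partial_character q H' \<chi>' \<and> H \<subseteq> H' \<and> {a. a < q \<and> coprime a q} \<subseteq> H' \<and>
      (\<forall>a\<in>H. \<chi>' a = \<chi> a)"
    by (rule partial_character_extend_finite) (use pc q in auto)
  then obtain H' \<chi>' where H': "partial_character q H' \<chi>'" "H \<subseteq> H'"
    "{a. a < q \<and> coprime a q} \<subseteq> H'" "\<forall>a\<in>H. \<chi>' a = \<chi> a" by blast
  note D = partial_characterD[OF H'(1)]
  have iff: "a \<in> H' \<longleftrightarrow> coprime a q" for a
  proof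
    assume "coprime a q"
    then have "a mod q \<in> H'" using H'(3) q by auto
    moreover have "[a mod q = a] (mod q)" by simp
    ultimately show "a \<in> H'" by (rule D(5))
  qed (rule D(1))
  define \<psi> where "\<psi> = (\<lambda>a. if coprime a q then \<chi>' a else 0)"
  have "\<psi> \<in> dirichlet_characters q"
    unfolding dirichlet_characters_def \<psi>_def
  proof (intro CollectI conjI allI)
    fix a b
    show "(if coprime (a * b) q then \<chi>' (a * b) else 0) =
      (if coprime a q then \<chi>' a else 0) * (if coprime b q then \<chi>' b else 0)"
      using D(4)[of a b] iff[of a] iff[of b] by simp
  next
    fix a
    have "[a = a + q] (mod q)" by (simp add: cong_def)
    then show "(if coprime (a + q) q then \<chi>' (a + q) else 0) = (if coprime a q then \<chi>' a else 0)"
      using D(6)[of a "a + q"] iff[of a] cong_imp_coprime[OF \<open>[a = a + q] (mod q)\<close>]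
        cong_imp_coprime[OF cong_sym[OF \<open>[a = a + q] (mod q)\<close>]]
      by (cases "coprime a q") auto
  next
    fix a
    show "((if coprime a q then \<chi>' a else 0) \<noteq> 0) = coprime a q"
      using D(7)[of a] iff[of a] by simp
  qed
  moreover have "\<forall>a\<in>H. \<psi> a = \<chi> a" using H' D(1) unfolding \<psi>_def by auto
  ultimately show ?thesis by blast
qed

text \<open>To the trivial character on the class of 1 the element \<open>a\<close> is adjoined with
  a value \<open>z \<noteq> 1\<close> satisfying \<open>z ^ ord q a = 1\<close>. Such a root of
  unity exists because \<open>ord q a > 1\<close>.\<close>

lemma dirichlet_character_separates:
  assumes q: "q > 0" and a: "coprime a q" and a1: "\<not> [a = 1] (mod q)"
  shows "\<exists>\<chi>\<in>dirichlet_characters q. \<chi> a \<noteq> 1"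
proof -
  have "ord q a \<noteq> 0" using a by (simp add: coprime_commute)
  moreover have "ord q a \<noteq> 1"
  proof
    assume "ord q a = 1"
    then have "[a ^ 1 = 1] (mod q)" using ord[of a q] by simp
    then show False using a1 by simp
  qed
  ultimately have ord: "ord q a > 1" by linarith
  have "\<not> {z::complex. z ^ ord q a = 1} \<subseteq> {1}"
  proof
    assume "{z::complex. z ^ ord q a = 1} \<subseteq> {1}"
    then have "card {z::complex. z ^ ord q a = 1} \<le> card {1::complex}"
      by (intro card_mono) simp_all
    then have "card {z::complex. z ^ ord q a = 1} \<le> 1" by simp
    then show False using card_roots_unity_eq[of "ord q a"] ord by linarith
  qed
  then obtain z :: complex where z: "z ^ ord q a = 1" "z \<noteq> 1" by blast
  have z0: "z \<noteq> 0"
  proof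
    assume "z = 0"
    then show False using z(1) ord power_0_left[of "ord q a", where 'a = complex] by simp
  qed
  have pc: "partial_character q {b. [b = 1] (mod q)} (\<lambda>_. 1)"
    unfolding partial_character_def
  proof (intro conjI ballI allI impI subsetI; (elim CollectE)?)
    fix b assume "[b = 1] (mod q)"
    from cong_imp_coprime[OF cong_sym[OF this]] have "coprime b q" by simp
    then show "b \<in> {a. coprime a q}" by simp
  next
    fix b c assume "[b = 1] (mod q)" "[c = 1] (mod q)"
    from cong_mult[OF this] show "b * c \<in> {b. [b = 1] (mod q)}" by simp
  next
    fix b c assume "[b = 1] (mod q)" "[b = c] (mod q)"
    from cong_trans[OF cong_sym[OF this(2)] this(1)] show "c \<in> {b. [b = 1] (mod q)}" by simp
  qed simp_all
  have zm: "z ^ m = 1" if "a ^ m \<in> {b. [b = 1] (mod q)}" for m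
  proof -
    have "ord q a dvd m" using that ord_divides[of a m q] by simp
    then show ?thesis using z(1) unfolding dvd_def by (auto simp: power_mult)
  qed
  obtain H' \<chi>' where H': "partial_character q H' \<chi>'" "a \<in> H'" "\<chi>' a = z"
    using partial_character_adjoin[OF pc q a z0 zm] by blast
  then show ?thesis using partial_character_extend_dirichlet[OF H'(1) q] z(2) by metis
qed

section \<open>Orthogonality of Dirichlet characters\<close>

lemma dirichlet_characterD:
  assumes "\<chi> \<in> dirichlet_characters q"
  shows "\<chi> (a * b) = \<chi> a * \<chi> b" "\<chi> (a + q) = \<chi> a" "\<chi> a \<noteq> 0 \<longleftrightarrow> coprime a q"
  using assms unfolding dirichlet_characters_def by blast+

lemma dirichlet_character_one:
  assumes "\<chi> \<in> dirichlet_characters q"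
  shows "\<chi> 1 = 1"
  using dirichlet_characterD(1)[OF assms, of 1 1] dirichlet_characterD(3)[OF assms, of 1] by simp

lemma dirichlet_character_mod:
  assumes "\<chi> \<in> dirichlet_characters q"
  shows "\<chi> (a mod q) = \<chi> a"
proof -
  have "\<chi> (r + k * q) = \<chi> r" for r k
  proof (induction k)
    case (Suc k)
    then show ?case using dirichlet_characterD(2)[OF assms, of "r + k * q"] by (simp add: add_ac)
  qed simp
  from this[of "a mod q" "a div q"] show ?thesis by simp
qed

lemma dirichlet_character_cong:
  assumes "\<chi> \<in> dirichlet_characters q" "[a = b] (mod q)"
  shows "\<chi> a = \<chi> b"
  using dirichlet_character_mod[OF assms(1)] assms(2) unfolding cong_def by metis

lemma dirichlet_character_pow_totient:
  assumes "\<chi> \<in> dirichlet_characters q" "coprime a q"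
  shows "\<chi> a ^ totient q = 1"
proof -
  have "\<chi> (a ^ m) = \<chi> a ^ m" for m
    by (induction m)
       (simp_all add: dirichlet_character_one[OF assms(1), simplified] dirichlet_characterD(1)[OF assms(1)])
  then show ?thesis
    using dirichlet_character_cong[OF assms(1) euler_theorem[OF assms(2)]]
      dirichlet_character_one[OF assms(1)] by simp
qed

lemma norm_dirichlet_character:
  assumes "\<chi> \<in> dirichlet_characters q" "coprime a q" "q > 0"
  shows "cmod (\<chi> a) = 1"
proof -
  have "cmod (\<chi> a) ^ totient q = 1"
    using dirichlet_character_pow_totient[OF assms(1,2)] by (simp flip: norm_power)
  moreover have "totient q > 0" using assms(3) by simp
  ultimately show ?thesis using power_eq_imp_eq_base[of "cmod (\<chi> a)" "totient q" 1] by simp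
qed

text \<open>By periodicity a character is determined by its values below \<open>q\<close>, and each
  of these is 0 or a root of unity of order dividing \<open>totient q\<close>.\<close>

lemma finite_dirichlet_characters:
  assumes "q > 0"
  shows "finite (dirichlet_characters q)"
proof -
  let ?Z = "insert 0 {z::complex. z ^ totient q = 1}"
  have tq: "totient q > 0" using assms by simp
  have "finite (PiE {..<q} (\<lambda>_. ?Z))" using finite_nth_roots[OF tq] by (intro finite_PiE) auto
  moreover have "(\<lambda>\<chi>. restrict \<chi> {..<q}) ` dirichlet_characters q \<subseteq> PiE {..<q} (\<lambda>_. ?Z)"
  proof (intro image_subsetI PiE_I)
    fix \<chi> a assume \<chi>: "\<chi> \<in> dirichlet_characters q" and a: "a \<in> {..<q}"
    have "\<chi> a = 0 \<or> \<chi> a ^ totient q = 1"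
      using dirichlet_character_pow_totient[OF \<chi>, of a] dirichlet_characterD(3)[OF \<chi>, of a] by blast
    then show "restrict \<chi> {..<q} a \<in> ?Z" using a by simp
  qed simp
  moreover have "inj_on (\<lambda>\<chi>. restrict \<chi> {..<q}) (dirichlet_characters q)"
  proof (intro inj_onI ext)
    fix \<chi> \<psi> a
    assume *: "\<chi> \<in> dirichlet_characters q" "\<psi> \<in> dirichlet_characters q"
      "restrict \<chi> {..<q} = restrict \<psi> {..<q}"
    have "restrict \<chi> {..<q} (a mod q) = restrict \<psi> {..<q} (a mod q)" using *(3) by simp
    then have "\<chi> (a mod q) = \<psi> (a mod q)" using assms by simp
    then show "\<chi> a = \<psi> a"
      using dirichlet_character_mod[OF *(1)] dirichlet_character_mod[OF *(2)] by simp
  qed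
  ultimately show ?thesis using finite_imageD finite_subset by blast
qed

lemma dirichlet_character_mult:
  assumes "\<chi> \<in> dirichlet_characters q" "\<psi> \<in> dirichlet_characters q"
  shows "(\<lambda>a. \<chi> a * \<psi> a) \<in> dirichlet_characters q"
  using assms unfolding dirichlet_characters_def by auto

text \<open>Multiplication by a character \<open>\<psi>\<close> with
  \<open>\<psi> a \<noteq> 1\<close> permutes the characters, so the sum equals
  \<open>\<psi> a\<close> times itself.\<close>

lemma sum_dirichlet_characters_eq_0:
  assumes q: "q > 0" and a: "coprime a q" "\<not> [a = 1] (mod q)"
  shows "(\<Sum>\<chi>\<in>dirichlet_characters q. \<chi> a) = 0"
proof -
  let ?D = "dirichlet_characters q"
  obtain \<psi> where \<psi>: "\<psi> \<in> ?D" "\<psi> a \<noteq> 1" using dirichlet_character_separates[OF q a] by blast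
  let ?f = "\<lambda>\<chi> b. \<psi> b * \<chi> b"
  have inj: "inj_on ?f ?D"
  proof (intro inj_onI ext)
    fix \<chi> \<chi>' b assume *: "\<chi> \<in> ?D" "\<chi>' \<in> ?D" "?f \<chi> = ?f \<chi>'"
    from *(3) have e: "\<psi> b * \<chi> b = \<psi> b * \<chi>' b" by (rule fun_cong)
    show "\<chi> b = \<chi>' b"
    proof (cases "coprime b q")
      case True
      then have "\<psi> b \<noteq> 0" using dirichlet_characterD(3)[OF \<psi>(1)] by blast
      then show ?thesis using e by simp
    next
      case False
      then show ?thesis
        using dirichlet_characterD(3)[OF *(1), of b] dirichlet_characterD(3)[OF *(2), of b] by simp
    qed
  qed
  have "?f ` ?D = ?D"
    by (rule endo_inj_surj[OF finite_dirichlet_characters[OF q] _ inj])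
       (use dirichlet_character_mult[OF \<psi>(1)] in auto)
  then have "(\<Sum>\<chi>\<in>?D. \<chi> a) = (\<Sum>\<chi>\<in>?f ` ?D. \<chi> a)" by simp
  also have "\<dots> = \<psi> a * (\<Sum>\<chi>\<in>?D. \<chi> a)"
    using inj by (simp add: sum.reindex sum_distrib_left)
  finally show ?thesis using \<psi>(2) by simp
qed

text \<open>Multiplication by \<open>b\<close> permutes the reduced residues, so the sum equals
  \<open>\<chi> b\<close> times itself.\<close>

lemma sum_totatives_dirichlet_character_eq_0:
  assumes q: "q \<ge> 2" and \<chi>: "\<chi> \<in> dirichlet_characters q" and b: "coprime b q" "\<chi> b \<noteq> 1"
  shows "(\<Sum>a\<in>totatives q. \<chi> a) = 0"
proof -
  let ?f = "\<lambda>a. (b * a) mod q"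
  have inj: "inj_on ?f (totatives q)"
  proof (rule inj_onI)
    fix x y assume *: "x \<in> totatives q" "y \<in> totatives q" "?f x = ?f y"
    then have "[b * x = b * y] (mod q)" unfolding cong_def by simp
    then have "[x = y] (mod q)" using cong_mult_lcancel_nat[OF b(1)] by simp
    moreover have "x < q" "y < q" using totatives_less *(1,2) q by simp_all
    ultimately show "x = y" by (simp add: cong_def)
  qed
  have "?f ` totatives q \<subseteq> totatives q"
  proof
    fix y assume "y \<in> ?f ` totatives q"
    then obtain x where x: "x \<in> totatives q" "y = ?f x" by blast
    then have "coprime y q" using b(1) q by (simp add: in_totatives_iff)
    moreover have "y \<noteq> 0"
    proof
      assume "y = 0"
      then show False using \<open>coprime y q\<close> q by simp
    qed
    moreover have "y < q" using x q by simp
    ultimately show "y \<in> totatives q" by (simp add: in_totatives_iff)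
  qed
  then have "?f ` totatives q = totatives q" by (intro endo_inj_surj[OF _ _ inj]) auto
  then have "(\<Sum>a\<in>totatives q. \<chi> a) = (\<Sum>a\<in>?f ` totatives q. \<chi> a)" by simp
  also have "\<dots> = \<chi> b * (\<Sum>a\<in>totatives q. \<chi> a)"
    using inj by (simp add: sum.reindex sum_distrib_left dirichlet_character_mod[OF \<chi>] dirichlet_characterD(1)[OF \<chi>])
  finally show ?thesis using b(2) by simp
qed

text \<open>The sum of \<open>\<chi> a\<close> over all characters and reduced residues is evaluated
  in both orders. With the characters inside only \<open>a = 1\<close> survives, giving the number
  of characters; with the residues inside only the principal character \<open>\<chi>0\<close>
  survives, giving \<open>totient q\<close>.\<close>

lemma card_dirichlet_characters:
  assumes q: "q \<ge> 2"
  shows "card (dirichlet_characters q) = totient q"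
proof -
  let ?D = "dirichlet_characters q" and ?T = "totatives q"
  define \<chi>0 where "\<chi>0 = (\<lambda>a. if coprime a q then 1 else 0 :: complex)"
  have coprime_shift: "coprime (a + q) q \<longleftrightarrow> coprime a q" for a
    unfolding coprime_iff_gcd_eq_1 by simp
  have \<chi>0: "\<chi>0 \<in> ?D" unfolding \<chi>0_def dirichlet_characters_def
    using coprime_shift by auto
  have fin: "finite ?D" using q finite_dirichlet_characters by simp
  have one: "1 \<in> ?T" using q by (simp add: in_totatives_iff)
  have "(\<Sum>a\<in>?T. \<Sum>\<chi>\<in>?D. \<chi> a) = (\<Sum>a\<in>{1}. \<Sum>\<chi>\<in>?D. \<chi> a)"
  proof (rule sum.mono_neutral_right)
    show "\<forall>a\<in>?T - {1}. (\<Sum>\<chi>\<in>?D. \<chi> a) = 0"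
    proof
      fix a assume a: "a \<in> ?T - {1}"
      then have "\<not> [a = 1] (mod q)"
        using q totatives_less[of a q] by (simp add: cong_def)
      then show "(\<Sum>\<chi>\<in>?D. \<chi> a) = 0"
        using a q by (intro sum_dirichlet_characters_eq_0) (auto simp: in_totatives_iff)
    qed
  qed (use one in auto)
  also have "\<dots> = of_nat (card ?D)"
  proof -
    have "(\<Sum>\<chi>\<in>?D. \<chi> 1) = (\<Sum>\<chi>\<in>?D. 1)" using dirichlet_character_one by (intro sum.cong) auto
    then show ?thesis by simp
  qed
  finally have 1: "(\<Sum>a\<in>?T. \<Sum>\<chi>\<in>?D. \<chi> a) = of_nat (card ?D)" .
  have "(\<Sum>\<chi>\<in>?D. \<Sum>a\<in>?T. \<chi> a) = (\<Sum>\<chi>\<in>{\<chi>0}. \<Sum>a\<in>?T. \<chi> a)"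
  proof (rule sum.mono_neutral_right[OF fin])
    show "\<forall>\<chi>\<in>?D - {\<chi>0}. (\<Sum>a\<in>?T. \<chi> a) = 0"
    proof
      fix \<chi> assume \<chi>: "\<chi> \<in> ?D - {\<chi>0}"
      then obtain b where b: "\<chi> b \<noteq> \<chi>0 b" by auto
      \<comment> \<open>At a non-unit both characters vanish, so they can differ only at a
        unit.\<close>
      then have "coprime b q" using \<chi> dirichlet_characterD(3)[of \<chi> q b] by (auto simp: \<chi>0_def)
      then show "(\<Sum>a\<in>?T. \<chi> a) = 0"
        using b \<chi> q by (intro sum_totatives_dirichlet_character_eq_0[of q \<chi> b]) (auto simp: \<chi>0_def)
    qed
  qed (use \<chi>0 in auto)
  also have "\<dots> = of_nat (totient q)"
    by (simp add: \<chi>0_def in_totatives_iff totient_def)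
  finally have "(\<Sum>\<chi>\<in>?D. \<Sum>a\<in>?T. \<chi> a) = of_nat (totient q)" .
  then have "(of_nat (card ?D) :: complex) = of_nat (totient q)"
    using 1 sum.swap[of "\<lambda>\<chi> a. \<chi> a" ?T ?D] by simp
  then show ?thesis by (rule of_nat_eq_iff[THEN iffD1])
qed

text \<open>Character values at units have modulus 1, so \<open>cnj (\<chi> b)\<close> is the value
  at an inverse \<open>c\<close> of \<open>b\<close>. The product becomes
  \<open>\<chi> (a * c)\<close>, and a sum over one argument remains.\<close>

lemma dirichlet_character_orthogonality:
  assumes q: "q \<ge> 2" and a: "coprime a q" and b: "coprime b q"
  shows "(\<Sum>\<chi>\<in>dirichlet_characters q. \<chi> a * cnj (\<chi> b)) =
    (if [a = b] (mod q) then of_nat (totient q) else 0)"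
proof -
  obtain c where c: "[b * c = 1] (mod q)" using cong_solve_coprime_nat[OF b] by auto
  have cc: "coprime c q"
    using c cong_imp_coprime[OF cong_sym[OF c]] by simp
  have eq: "\<chi> a * cnj (\<chi> b) = \<chi> (a * c)" if \<chi>: "\<chi> \<in> dirichlet_characters q" for \<chi>
  proof -
    have "\<chi> b * \<chi> c = 1"
      using dirichlet_character_cong[OF \<chi> c] dirichlet_character_one[OF \<chi>] dirichlet_characterD(1)[OF \<chi>]
      by simp
    moreover have "cmod (\<chi> b) = 1"
      using norm_dirichlet_character[OF \<chi> b] q by simp
    then have "\<chi> b * cnj (\<chi> b) = 1" using complex_norm_square[of "\<chi> b"] by simp
    ultimately have "\<chi> b * cnj (\<chi> b) = \<chi> b * \<chi> c" by simp
    then have "cnj (\<chi> b) = \<chi> c" using dirichlet_characterD(3)[OF \<chi>, of b] b by simp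
    then show ?thesis using dirichlet_characterD(1)[OF \<chi>] by simp
  qed
  have "[a * c = 1] (mod q) \<longleftrightarrow> [a = b] (mod q)"
    using cong_mult_rcancel_nat[OF cc, of a b] cong_trans[OF _ c] cong_trans[OF _ cong_sym[OF c]]
    by blast
  moreover have "(\<Sum>\<chi>\<in>dirichlet_characters q. \<chi> (a * c)) =
    (if [a * c = 1] (mod q) then of_nat (totient q) else 0)"
  proof (cases "[a * c = 1] (mod q)")
    case True
    have "\<chi> (a * c) = 1" if "\<chi> \<in> dirichlet_characters q" for \<chi>
      using dirichlet_character_cong[OF that True] dirichlet_character_one[OF that] by simp
    then have "(\<Sum>\<chi>\<in>dirichlet_characters q. \<chi> (a * c)) = (\<Sum>\<chi>\<in>dirichlet_characters q. 1)"
      by (intro sum.cong) auto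
    then show ?thesis using True card_dirichlet_characters[OF q] by simp
  next
    case False
    then show ?thesis using sum_dirichlet_characters_eq_0[of q "a * c"] a cc q by simp
  qed
  ultimately show ?thesis using eq by simp
qed

section \<open>Character sums over divisors\<close>

lemma finite_divisors: "n > 0 \<Longrightarrow> finite (divisors n)"
  unfolding divisors_def by simp

text \<open>Expanding the squared modulus into a double sum over divisors and summing over the
  characters first, orthogonality leaves \<open>totient q\<close> for each congruent pair.\<close>

lemma congruent_divisor_pairs_eq_character_sum:
  assumes n: "n > 0" and q: "q \<ge> 2" and nq: "coprime n q"
  shows "real (congruent_divisor_pairs n q) =
    1 / real (totient q) * (\<Sum>\<chi>\<in>dirichlet_characters q. (cmod (\<Sum>d\<in>divisors n. \<chi> d))\<^sup>2)"
proof -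
  let ?D = "dirichlet_characters q" and ?V = "divisors n"
  have fin: "finite ?V" using n finite_divisors by simp
  have cop: "coprime d q" if "d \<in> ?V" for d
    using that coprime_divisors[OF _ dvd_refl nq] by (simp add: divisors_def)
  have "complex_of_real (\<Sum>\<chi>\<in>?D. (cmod (\<Sum>d\<in>?V. \<chi> d))\<^sup>2) =
      (\<Sum>\<chi>\<in>?D. (\<Sum>d\<in>?V. \<chi> d) * cnj (\<Sum>d\<in>?V. \<chi> d))"
    by (simp only: of_real_sum complex_norm_square)
  also have "\<dots> = (\<Sum>\<chi>\<in>?D. \<Sum>d\<in>?V. \<Sum>e\<in>?V. \<chi> d * cnj (\<chi> e))"
    by (simp add: sum_product)
  also have "\<dots> = (\<Sum>d\<in>?V. \<Sum>e\<in>?V. \<Sum>\<chi>\<in>?D. \<chi> d * cnj (\<chi> e))"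
    by (subst sum.swap, rule sum.cong[OF refl], rule sum.swap)
  also have "\<dots> = (\<Sum>d\<in>?V. \<Sum>e\<in>?V. if [d = e] (mod q) then of_nat (totient q) else 0)"
    using dirichlet_character_orthogonality[OF q] cop by (intro sum.cong) auto
  also have "\<dots> = (\<Sum>(d, e)\<in>?V \<times> ?V. if [d = e] (mod q) then of_nat (totient q) else 0)"
    by (simp add: sum.cartesian_product)
  also have "\<dots> = (\<Sum>(d, e)\<in>{(d, e). d \<in> ?V \<and> e \<in> ?V \<and> [d = e] (mod q)}. of_nat (totient q))"
    using fin by (intro sum.mono_neutral_cong_right) (auto split: if_splits)
  also have "\<dots> = of_nat (totient q) * of_nat (congruent_divisor_pairs n q)"
    unfolding congruent_divisor_pairs_def by simp
  also have "\<dots> = complex_of_real (real (totient q) * real (congruent_divisor_pairs n q))" by simp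
  finally have "(\<Sum>\<chi>\<in>?D. (cmod (\<Sum>d\<in>?V. \<chi> d))\<^sup>2) =
      real (totient q) * real (congruent_divisor_pairs n q)"
    by (rule of_real_eq_iff[THEN iffD1])
  moreover have "totient q > 0" using q by simp
  ultimately show ?thesis by simp
qed

lemma sum_divisors_coprime_mult:
  fixes f :: "nat \<Rightarrow> 'a::comm_semiring_1"
  assumes mk: "coprime m k" and pos: "m > 0" "k > 0"
  shows "(\<Sum>d\<in>divisors (m * k). f d) = (\<Sum>a\<in>divisors m. \<Sum>b\<in>divisors k. f (a * b))"
proof -
  let ?g = "\<lambda>(a, b). a * b"
  have inj: "inj_on ?g (divisors m \<times> divisors k)"
  proof (rule inj_onI, clarify)
    fix a b a' b' assume *: "a \<in> divisors m" "b \<in> divisors k" "a' \<in> divisors m" "b' \<in> divisors k"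
      "a * b = a' * b'"
    \<comment> \<open>The first factor is recovered as the gcd of the product with \<open>m\<close>,
      which gives injectivity.\<close>
    have g: "gcd (x * y) m = x" if "x \<in> divisors m" "y \<in> divisors k" for x y
    proof -
      have "coprime y m"
        using that(2) coprime_divisors[OF _ dvd_refl, of y k m]
        by (simp add: divisors_def mk[THEN coprime_commute[THEN iffD1]])
      then have "gcd (x * y) m = gcd x m"
        by (intro gcd_mult_left_right_cancel) (rule coprime_commute[THEN iffD1])
      then show ?thesis using that by (simp add: divisors_def)
    qed
    have "a = a'" using g[OF *(1,2)] g[OF *(3,4)] *(5) by simp
    moreover have "a \<noteq> 0" using *(1) by (simp add: divisors_def)
    ultimately show "a = a' \<and> b = b'" using *(5) by simp
  qed
  have im: "?g ` (divisors m \<times> divisors k) = divisors (m * k)"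
  proof (intro equalityI subsetI)
    fix d assume "d \<in> divisors (m * k)"
    then have "d dvd m * k" "d > 0" by (simp_all add: divisors_def)
    from division_decomp[OF this(1)] obtain a b where "d = a * b" "a dvd m" "b dvd k" by blast
    then have "(a, b) \<in> divisors m \<times> divisors k" using \<open>d > 0\<close> by (simp add: divisors_def)
    then show "d \<in> (\<lambda>(a, b). a * b) ` (divisors m \<times> divisors k)"
      unfolding \<open>d = a * b\<close> by (rule image_eqI[rotated]) simp
  next
    fix d assume "d \<in> (\<lambda>(a, b). a * b) ` (divisors m \<times> divisors k)"
    then obtain a b where "d = a * b" "a \<in> divisors m" "b \<in> divisors k" by auto
    then show "d \<in> divisors (m * k)" by (simp add: divisors_def mult_dvd_mono)
  qed
  have "(\<Sum>d\<in>divisors (m * k). f d) = (\<Sum>d\<in>?g ` (divisors m \<times> divisors k). f d)"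
    unfolding im ..
  also have "\<dots> = sum (f \<circ> ?g) (divisors m \<times> divisors k)"
    by (rule sum.reindex[OF inj])
  also have "\<dots> = (\<Sum>(a, b)\<in>divisors m \<times> divisors k. f (a * b))"
    by (intro sum.cong) auto
  also have "\<dots> = (\<Sum>a\<in>divisors m. \<Sum>b\<in>divisors k. f (a * b))"
    by (rule sum.cartesian_product[symmetric])
  finally show ?thesis .
qed

lemma tau_coprime_mult:
  assumes "coprime m k" "m > 0" "k > 0"
  shows "tau (m * k) = tau m * tau k"
  using sum_divisors_coprime_mult[OF assms, of "\<lambda>_. 1::nat"] unfolding tau_def by simp

text \<open>For each character the sum over the divisors of \<open>m * k\<close> factors. The factor
  from \<open>k\<close> is bounded trivially by \<open>tau k\<close>, and the remaining factors
  reassemble to the count for \<open>m\<close>.\<close>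

lemma congruent_divisor_pairs_coprime_mult_le:
  assumes mk: "coprime m k" and pos: "m > 0" "k > 0" and q: "q \<ge> 2" and c: "coprime (m * k) q"
  shows "real (congruent_divisor_pairs (m * k) q) \<le> (real (tau k))\<^sup>2 * real (congruent_divisor_pairs m q)"
proof -
  let ?D = "dirichlet_characters q"
  have cm: "coprime m q" using c by simp
  have le: "(cmod (\<Sum>d\<in>divisors (m * k). \<chi> d))\<^sup>2 \<le> (real (tau k))\<^sup>2 * (cmod (\<Sum>d\<in>divisors m. \<chi> d))\<^sup>2"
    if \<chi>: "\<chi> \<in> ?D" for \<chi>
  proof -
    have n1: "cmod (\<chi> b) \<le> 1" for b
    proof (cases "coprime b q")
      case True
      then show ?thesis using norm_dirichlet_character[OF \<chi>] q by simp
    next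
      case False
      then have "\<chi> b = 0" using dirichlet_characterD(3)[OF \<chi>] by blast
      then show ?thesis by simp
    qed
    have "(\<Sum>d\<in>divisors (m * k). \<chi> d) = (\<Sum>d\<in>divisors m. \<chi> d) * (\<Sum>d\<in>divisors k. \<chi> d)"
      unfolding sum_divisors_coprime_mult[OF mk pos] sum_product dirichlet_characterD(1)[OF \<chi>] ..
    then have "(cmod (\<Sum>d\<in>divisors (m * k). \<chi> d))\<^sup>2 =
        (cmod (\<Sum>d\<in>divisors k. \<chi> d))\<^sup>2 * (cmod (\<Sum>d\<in>divisors m. \<chi> d))\<^sup>2"
      by (simp add: norm_mult power_mult_distrib)
    also have "\<dots> \<le> (real (tau k))\<^sup>2 * (cmod (\<Sum>d\<in>divisors m. \<chi> d))\<^sup>2"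
      using sum_norm_le[of "divisors k" \<chi> "\<lambda>_. 1"] n1
      by (intro mult_right_mono power_mono) (simp_all add: tau_def)
    finally show ?thesis .
  qed
  have "real (congruent_divisor_pairs (m * k) q) =
      1 / real (totient q) * (\<Sum>\<chi>\<in>?D. (cmod (\<Sum>d\<in>divisors (m * k). \<chi> d))\<^sup>2)"
    using pos by (intro congruent_divisor_pairs_eq_character_sum q c) simp
  also have "\<dots> \<le> 1 / real (totient q) * (\<Sum>\<chi>\<in>?D. (real (tau k))\<^sup>2 * (cmod (\<Sum>d\<in>divisors m. \<chi> d))\<^sup>2)"
    by (intro mult_left_mono sum_mono le) simp_all
  also have "\<dots> = (real (tau k))\<^sup>2 *
      (1 / real (totient q) * (\<Sum>\<chi>\<in>?D. (cmod (\<Sum>d\<in>divisors m. \<chi> d))\<^sup>2))"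
    by (simp flip: sum_distrib_left)
  also have "\<dots> = (real (tau k))\<^sup>2 * real (congruent_divisor_pairs m q)"
    unfolding congruent_divisor_pairs_eq_character_sum[OF pos(1) q cm] ..
  finally show ?thesis .
qed

section \<open>Divisors in a residue class\<close>

text \<open>Each logarithm is the sum of the Mangoldt function over divisors; the order of summation
  is then exchanged. This treats all prime powers at once.\<close>

lemma sum_ln_eq_sum_mangoldt:
  assumes "n > 0" "finite S" "\<And>x. x \<in> S \<Longrightarrow> f x dvd n"
  shows "(\<Sum>x\<in>S. ln (real (f x))) =
    (\<Sum>d | d dvd n. mangoldt d * real (card {x\<in>S. d dvd f x}))"
proof -
  have "ln (real (f x)) = (\<Sum>d | d dvd n. mangoldt d * of_bool (d dvd f x))" if x: "x \<in> S" for x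
  proof -
    have "f x \<noteq> 0" using assms(1) assms(3)[OF x] by (metis dvd_0_left less_irrefl)
    then have "ln (real (f x)) = (\<Sum>d | d dvd f x. mangoldt d)" using mangoldt_sum[of "f x", where 'a = real] by simp
    also have "\<dots> = (\<Sum>d | d dvd n. mangoldt d * of_bool (d dvd f x))"
      using assms(1) dvd_trans[OF _ assms(3)[OF x]]
      by (intro sum.mono_neutral_cong_left) auto
    finally show ?thesis .
  qed
  then have "(\<Sum>x\<in>S. ln (real (f x))) = (\<Sum>x\<in>S. \<Sum>d | d dvd n. mangoldt d * of_bool (d dvd f x))"
    by simp
  also have "\<dots> = (\<Sum>d | d dvd n. \<Sum>x\<in>S. mangoldt d * of_bool (d dvd f x))" by (rule sum.swap)
  also have "\<dots> = (\<Sum>d | d dvd n. mangoldt d * real (card {x\<in>S. d dvd f x}))"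
  proof (rule sum.cong[OF refl])
    fix d
    have "(\<Sum>x\<in>S. of_bool (d dvd f x)) = real (card {x\<in>S. d dvd f x})"
      using assms(2) by (simp add: of_bool_def sum.If_cases Int_def)
    then show "(\<Sum>x\<in>S. mangoldt d * of_bool (d dvd f x)) = mangoldt d * real (card {x\<in>S. d dvd f x})"
      by (simp flip: sum_distrib_left)
  qed
  finally show ?thesis .
qed

text \<open>
  With \<open>m d\<close> the number of multiples of \<open>d\<close> in \<open>S\<close>, the claim is the nonnegativity of
  \<open>(m d - a) * (m d - a - 1)\<close> weighted by the Mangoldt function.
\<close>
lemma sum_ln_gcd_ge:
  fixes a :: int
  assumes n: "n > 0" and S: "finite S" "\<And>x. x \<in> S \<Longrightarrow> x dvd n"
  shows "(2 * a + 1) * (\<Sum>x\<in>S. ln (real x)) - a * (a + 1) * ln (real n)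
    \<le> (\<Sum>(x, y)\<in>S \<times> S. ln (real (gcd x y)))"
proof -
  define m where "m = (\<lambda>d. int (card {x\<in>S. d dvd x}))"
  have 1: "(\<Sum>x\<in>S. ln (real x)) = (\<Sum>d | d dvd n. mangoldt d * m d)"
    using sum_ln_eq_sum_mangoldt[OF n S(1), of "\<lambda>x. x"] S(2) unfolding m_def by simp
  have "(\<Sum>(x, y)\<in>S \<times> S. ln (real (gcd x y))) =
      (\<Sum>d | d dvd n. mangoldt d * real (card {p\<in>S \<times> S. d dvd gcd (fst p) (snd p)}))"
    using sum_ln_eq_sum_mangoldt[OF n finite_cartesian_product[OF S(1) S(1)], of "\<lambda>p. gcd (fst p) (snd p)"] S(2)
    by (fastforce simp: case_prod_unfold)
  also have "\<dots> = (\<Sum>d | d dvd n. mangoldt d * (real_of_int (m d))\<^sup>2)"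
  proof (rule sum.cong[OF refl])
    fix d
    \<comment> \<open>A divisor of the gcd divides both entries, so the pairs counted number
      \<open>m d\<close> squared.\<close>
    have "{p\<in>S \<times> S. d dvd gcd (fst p) (snd p)} = {x\<in>S. d dvd x} \<times> {x\<in>S. d dvd x}" by auto
    then show "mangoldt d * real (card {p\<in>S \<times> S. d dvd gcd (fst p) (snd p)}) = mangoldt d * (real_of_int (m d))\<^sup>2"
      by (simp add: m_def card_cartesian_product power2_eq_square)
  qed
  finally have 2: "(\<Sum>(x, y)\<in>S \<times> S. ln (real (gcd x y))) = (\<Sum>d | d dvd n. mangoldt d * (real_of_int (m d))\<^sup>2)" .
  have 3: "ln (real n) = (\<Sum>d | d dvd n. mangoldt d)" using mangoldt_sum[of n, where 'a = real] n by simp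
  have "(2 * a + 1) * (\<Sum>x\<in>S. ln (real x)) - a * (a + 1) * ln (real n) =
      (\<Sum>d | d dvd n. mangoldt d * real_of_int ((2 * a + 1) * m d - a * (a + 1)))"
    unfolding 1 3 by (simp add: sum_distrib_left sum_subtractf sum.distrib algebra_simps)
  also have "\<dots> \<le> (\<Sum>d | d dvd n. mangoldt d * (real_of_int (m d))\<^sup>2)"
  proof (intro sum_mono mult_left_mono mangoldt_nonneg)
    fix d
    \<comment> \<open>The factors are consecutive integers, so they cannot have opposite
      signs.\<close>
    have "(m d - a) * (m d - a - 1) \<ge> 0"
      by (cases "m d - a \<ge> 1") (auto intro: mult_nonneg_nonneg mult_nonpos_nonpos)
    then have "(2 * a + 1) * m d - a * (a + 1) \<le> (m d)\<^sup>2"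
      by (simp add: algebra_simps power2_eq_square)
    then show "real_of_int ((2 * a + 1) * m d - a * (a + 1)) \<le> (real_of_int (m d))\<^sup>2"
      by (metis of_int_le_iff of_int_power)
  qed
  finally show ?thesis using 2 by simp
qed

section \<open>Congruent divisors in one window\<close>

text \<open>Both \<open>q\<close> and \<open>gcd x y\<close> divide the positive number
  \<open>y - x\<close>, and they are coprime because \<open>gcd x y\<close> divides
  \<open>x\<close>.\<close>

lemma cong_distinct_gcd_bound:
  fixes x y q :: nat
  assumes "[x = y] (mod q)" "x < y" "coprime x q"
  shows "q * gcd x y \<le> y"
proof -
  have "q dvd y - x" using assms(1,2) by (metis cong_altdef_nat cong_sym less_imp_le)
  moreover have "gcd x y dvd y - x" by (simp add: dvd_diff_nat)
  moreover have "coprime q (gcd x y)"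
    using assms(3) by (meson coprime_commute coprime_divisors dvd_refl gcd_dvd1)
  ultimately have "q * gcd x y dvd y - x" by (rule divides_mult)
  then have "q * gcd x y \<le> y - x" using assms(2) by (intro dvd_imp_le) auto
  then show ?thesis by simp
qed

text \<open>The pairwise bound on \<open>q * gcd x y\<close>, summed in logarithms over ordered
  pairs of distinct elements, bounds the off-diagonal gcd sum from above.
  \<open>sum_ln_gcd_ge\<close> bounds it from below, with the integer \<open>a\<close> still to be
  chosen.\<close>

lemma cong_divisors_window_inequality:
  fixes a :: int and k B D :: real
  assumes n: "n > 0" and q: "q > 0" "coprime n q"
    and S: "finite S" "\<And>x. x \<in> S \<Longrightarrow> x dvd n"
    and cong: "\<And>x y. x \<in> S \<Longrightarrow> y \<in> S \<Longrightarrow> [x = y] (mod q)"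
    and win: "\<And>x. x \<in> S \<Longrightarrow> B \<le> ln (real x)" "\<And>x. x \<in> S \<Longrightarrow> ln (real x) \<le> B + D"
    and a: "a \<ge> 0" and k: "k = real (card S)"
  shows "k * (k - 1) * (ln (real q) - D) \<le>
    k * (k - 1) * B - 2 * a * k * B + a * (a + 1) * ln (real n)"
proof -
  define P where "P = S \<times> S - (\<lambda>x. (x, x)) ` S"
  have pos: "x > 0" if "x \<in> S" for x using S(2)[OF that] n by (metis dvd_0_left neq0_conv)
  have cop: "coprime x q" if "x \<in> S" for x using S(2)[OF that] q(2) by (meson coprime_divisors dvd_refl)
  have le: "ln (real q) + ln (real (gcd x y)) \<le> B + D" if "x \<in> S" "y \<in> S" "x < y" for x y
  proof -
    have "q * gcd x y \<le> y" using cong_distinct_gcd_bound[OF cong[OF that(1,2)] that(3) cop[OF that(1)]] .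
    then have "real q * real (gcd x y) \<le> real y" by (metis of_nat_le_iff of_nat_mult)
    then have "ln (real q * real (gcd x y)) \<le> ln (real y)" using q pos[OF that(1)] pos[OF that(2)] by simp
    then have "ln (real q) + ln (real (gcd x y)) \<le> ln (real y)"
      using q pos[OF that(1)] by (simp add: ln_mult)
    then show ?thesis using win(2)[OF that(2)] by linarith
  qed
  have sub: "(\<lambda>x. (x, x)) ` S \<subseteq> S \<times> S" by auto
  have inj: "inj_on (\<lambda>x. (x, x)) S" by (auto simp: inj_on_def)
  have finP: "finite P" unfolding P_def using S(1) by simp
  have cardP: "real (card P) = k * (k - 1)"
  proof -
    have "card P = card S * card S - card S"
      unfolding P_def using S(1) sub inj by (simp add: card_Diff_subset card_cartesian_product card_image)
    moreover have "card S \<le> card S * card S" by simp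
    ultimately show ?thesis unfolding k by (simp add: of_nat_diff algebra_simps)
  qed
  have "(\<Sum>(x, y)\<in>P. ln (real q) + ln (real (gcd x y))) \<le> (\<Sum>(x, y)\<in>P. B + D)"
  proof (intro sum_mono, clarify)
    fix x y assume "(x, y) \<in> P"
    then have "x \<in> S" "y \<in> S" "x \<noteq> y" unfolding P_def by auto
    then show "ln (real q) + ln (real (gcd x y)) \<le> B + D"
      using le[of x y] le[of y x] by (cases "x < y") (auto simp: gcd.commute)
  qed
  then have 1: "k * (k - 1) * ln (real q) + (\<Sum>(x, y)\<in>P. ln (real (gcd x y))) \<le> k * (k - 1) * (B + D)"
    by (simp add: case_prod_unfold sum.distrib cardP)
  have "(\<Sum>(x, y)\<in>P. ln (real (gcd x y))) =
      (\<Sum>(x, y)\<in>S \<times> S. ln (real (gcd x y))) - (\<Sum>(x, y)\<in>(\<lambda>x. (x, x)) ` S. ln (real (gcd x y)))"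
    unfolding P_def using S(1) sub by (intro sum_diff) auto
  \<comment> \<open>Removing the diagonal subtracts one copy of the sum of \<open>ln x\<close>,
    which turns the factor \<open>2 * a + 1\<close> into \<open>2 * a\<close>.\<close>
  also have "(\<Sum>(x, y)\<in>(\<lambda>x. (x, x)) ` S. ln (real (gcd x y))) = (\<Sum>x\<in>S. ln (real x))"
    using inj by (simp add: sum.reindex)
  finally have 2: "2 * a * (\<Sum>x\<in>S. ln (real x)) - a * (a + 1) * ln (real n) \<le> (\<Sum>(x, y)\<in>P. ln (real (gcd x y)))"
    using sum_ln_gcd_ge[OF n S, of a] by (simp add: algebra_simps)
  have "k * B \<le> (\<Sum>x\<in>S. ln (real x))"
    using sum_mono[of S "\<lambda>_. B" "\<lambda>x. ln (real x)"] win(1) unfolding k by simp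
  then have "2 * a * (k * B) \<le> 2 * a * (\<Sum>x\<in>S. ln (real x))" using a by (intro mult_left_mono) auto
  then show ?thesis using 1 2 by (simp add: algebra_simps)
qed

text \<open>The window inequality is used with \<open>a\<close> near its minimising value
  \<open>\<beta> * k - 1/2\<close>. It yields
  \<open>(k - 1) * (1/4 + \<delta>) \<le> k * \<beta> * (1 - \<beta>)\<close>, and
  \<open>1/4 - \<beta> * (1 - \<beta>)\<close> is the square of
  \<open>\<beta> - 1/2\<close>.\<close>

lemma cong_divisors_window_card:
  assumes n: "n \<ge> 2" and q: "q > 0" "coprime n q"
    and S: "finite S" "\<And>x. x \<in> S \<Longrightarrow> x dvd n"
    and cong: "\<And>x y. x \<in> S \<Longrightarrow> y \<in> S \<Longrightarrow> [x = y] (mod q)"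
    and \<delta>: "0 < \<delta>" "\<delta> \<le> 1" and \<beta>: "\<beta> \<ge> 0"
    and win: "\<And>x. x \<in> S \<Longrightarrow> \<beta> * ln (real n) \<le> ln (real x)"
      "\<And>x. x \<in> S \<Longrightarrow> ln (real x) \<le> (\<beta> + \<delta>) * ln (real n)"
    and large: "(1/4 + 2 * \<delta>) * ln (real n) \<le> ln (real q)"
  shows "real (card S) * (\<delta> + (\<beta> - 1/2)\<^sup>2) \<le> 5/4"
proof (cases "card S = 0")
  case True
  then show ?thesis by simp
next
  case False
  define k N where "k = real (card S)" and "N = ln (real n)"
  have k1: "k \<ge> 1" using False unfolding k_def by simp
  have N: "N > 0" using n unfolding N_def by simp
  \<comment> \<open>Rounding down costs \<open>- f * (1 - f) \<le> 0\<close> below, so integrality of \<open>a\<close> loses nothing.\<close>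
  define a where "a = \<lfloor>\<beta> * k\<rfloor>"
  define f where "f = \<beta> * k - a"
  have f: "0 \<le> f" "f \<le> 1" unfolding f_def a_def by linarith+
  have a: "a \<ge> 0" unfolding a_def using \<beta> k1 by simp
  have "k * (k - 1) * (ln (real q) - \<delta> * N) \<le>
      k * (k - 1) * (\<beta> * N) - 2 * a * k * (\<beta> * N) + a * (a + 1) * N"
    unfolding N_def
    by (rule cong_divisors_window_inequality[OF _ q S cong])
       (use n win a in \<open>auto simp: k_def algebra_simps\<close>)
  also have "\<dots> = N * (k\<^sup>2 * \<beta> * (1 - \<beta>) - f * (1 - f))"
  proof -
    have e: "real_of_int a = \<beta> * k - f" unfolding f_def by simp
    show ?thesis
      unfolding of_int_mult of_int_add e by (simp add: algebra_simps power2_eq_square)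
  qed
  also have "\<dots> \<le> N * (k\<^sup>2 * \<beta> * (1 - \<beta>))"
    using N f by (intro mult_left_mono) auto
  finally have 1: "k * (k - 1) * (ln (real q) - \<delta> * N) \<le> N * (k\<^sup>2 * \<beta> * (1 - \<beta>))" .
  \<comment> \<open>Of the surplus \<open>2 * \<delta>\<close> in the size of \<open>q\<close>, one
    half pays for the width of the window and the other half remains as a gain.\<close>
  have "(1/4 + \<delta>) * N \<le> ln (real q) - \<delta> * N" using large unfolding N_def by (simp add: algebra_simps)
  then have "k * (k - 1) * ((1/4 + \<delta>) * N) \<le> k * (k - 1) * (ln (real q) - \<delta> * N)"
    using k1 by (intro mult_left_mono) auto
  then have "(k * N) * ((k - 1) * (1/4 + \<delta>)) \<le> (k * N) * (k * \<beta> * (1 - \<beta>))"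
    using 1 by (simp add: algebra_simps power2_eq_square)
  then have "(k - 1) * (1/4 + \<delta>) \<le> k * \<beta> * (1 - \<beta>)"
    using k1 N by (subst (asm) mult_le_cancel_left_pos) auto
  then have "k * (\<delta> + (\<beta> - 1/2)\<^sup>2) \<le> 1/4 + \<delta>"
    by (simp add: algebra_simps power2_eq_square diff_divide_distrib)
  then show ?thesis using \<delta> unfolding k_def by linarith
qed

section \<open>Summation over the windows\<close>

text \<open>Comparison with a telescoping sum; the subtracted term \<open>1 / (s + real m)\<close>
  carries the induction.\<close>

lemma sum_inverse_square_shift_le:
  fixes s :: real
  assumes "s \<ge> 1"
  shows "(\<Sum>i\<le>m. 1 / (s + real i)\<^sup>2) \<le> 2 / s - 1 / (s + real m)"
proof (induction m)
  case 0
  have "1 / s\<^sup>2 \<le> 1 / s" using assms by (simp add: divide_simps power2_eq_square)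
  then show ?case by simp
next
  case (Suc m)
  have "1 / (s + real (Suc m))\<^sup>2 \<le> 1 / ((s + real m) * (s + real (Suc m)))"
    using assms by (intro divide_left_mono) (auto simp: power2_eq_square intro!: mult_right_mono mult_pos_pos)
  also have "\<dots> = 1 / (s + real m) - 1 / (s + real (Suc m))"
    using assms by (simp add: divide_simps)
  finally show ?case using Suc by simp
qed

text \<open>At distance \<open>i\<close> from the centre \<open>j = R\<close> the summand is at most
  \<open>8 * R^2 / (sqrt R + i)^2\<close>. Summing the inverse squares gives order
  \<open>1 / sqrt R\<close> on each side, hence the exponent 3/2.\<close>

lemma sum_window_bounds_le:
  assumes R: "R \<ge> (1::nat)"
  shows "(\<Sum>j\<le>2 * R. 1 / (1 / (2 * real R) + (real j / (2 * real R) - 1/2)\<^sup>2)) \<le> 32 * real R powr (3/2)"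
proof -
  define s where "s = sqrt (real R)"
  have s: "s \<ge> 1" "s\<^sup>2 = real R" using R unfolding s_def by auto
  define g where "g = (\<lambda>i. 8 * (real R)\<^sup>2 * (1 / (s + real i)\<^sup>2))"
  have g: "1 / (1 / (2 * real R) + (real j / (2 * real R) - 1/2)\<^sup>2) \<le> g i"
    if i: "real i = \<bar>real j - real R\<bar>" for i j
  proof -
    have sq: "(real i)\<^sup>2 = (real j - real R)\<^sup>2" using i by simp
    have "1 / (2 * real R) + (real j / (2 * real R) - 1/2)\<^sup>2 = (2 * real R + (real i)\<^sup>2) / (4 * (real R)\<^sup>2)"
      unfolding sq using R by (simp add: field_simps power2_eq_square)
    moreover have "(s + real i)\<^sup>2 / 2 \<le> 2 * real R + (real i)\<^sup>2"
    proof -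
      have "0 \<le> (s - real i)\<^sup>2" by simp
      then have "(s + real i)\<^sup>2 \<le> 2 * s\<^sup>2 + 2 * (real i)\<^sup>2" by (simp add: power2_eq_square algebra_simps)
      then show ?thesis using s R by simp
    qed
    ultimately have "(s + real i)\<^sup>2 / 2 / (4 * (real R)\<^sup>2) \<le> 1 / (2 * real R) + (real j / (2 * real R) - 1/2)\<^sup>2"
      by (metis divide_right_mono zero_le_power2 mult_nonneg_nonneg zero_le_numeral)
    then have "1 / (1 / (2 * real R) + (real j / (2 * real R) - 1/2)\<^sup>2) \<le> 1 / ((s + real i)\<^sup>2 / 2 / (4 * (real R)\<^sup>2))"
      using s R by (intro divide_left_mono) (auto intro!: mult_pos_pos add_pos_nonneg divide_pos_pos)
    also have "\<dots> = g i" unfolding g_def by simp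
    finally show ?thesis .
  qed
  let ?h = "\<lambda>j. 1 / (1 / (2 * real R) + (real j / (2 * real R) - 1/2)\<^sup>2)"
  have h0: "?h j \<ge> 0" for j by simp
  \<comment> \<open>The range is folded at \<open>R\<close> into two halves; the centre is later
    counted in both, which only increases the bound.\<close>
  have "(\<Sum>j\<le>2 * R. ?h j) \<le> (\<Sum>j\<in>(\<lambda>i. R + i) ` {..R} \<union> (\<lambda>i. R - i) ` {..R}. ?h j)"
  proof (rule sum_mono2)
    show "{..2 * R} \<subseteq> (\<lambda>i. R + i) ` {..R} \<union> (\<lambda>i. R - i) ` {..R}"
    proof
      fix j assume j: "j \<in> {..2 * R}"
      show "j \<in> (\<lambda>i. R + i) ` {..R} \<union> (\<lambda>i. R - i) ` {..R}"
      proof (cases "j \<ge> R")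
        case True
        then have "j = R + (j - R)" "j - R \<in> {..R}" using j by auto
        then show ?thesis by blast
      next
        case False
        then have "j = R - (R - j)" "R - j \<in> {..R}" by auto
        then show ?thesis by blast
      qed
    qed
  qed (use h0 in auto)
  also have "\<dots> \<le> (\<Sum>j\<in>(\<lambda>i. R + i) ` {..R}. ?h j) + (\<Sum>j\<in>(\<lambda>i. R - i) ` {..R}. ?h j)"
    using h0 by (subst sum_Un) (auto intro!: sum_nonneg)
  also have "\<dots> = (\<Sum>i\<le>R. ?h (R + i)) + (\<Sum>i\<le>R. ?h (R - i))"
    by (subst (1 2) sum.reindex) (auto simp: inj_on_def)
  also have "\<dots> \<le> (\<Sum>i\<le>R. g i) + (\<Sum>i\<le>R. g i)"
    by (intro add_mono sum_mono g) (auto simp: of_nat_diff)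
  also have "\<dots> = 16 * (real R)\<^sup>2 * (\<Sum>i\<le>R. 1 / (s + real i)\<^sup>2)"
  proof -
    have "(\<Sum>i\<le>R. g i) = 8 * (real R)\<^sup>2 * (\<Sum>i\<le>R. 1 / (s + real i)\<^sup>2)"
      unfolding g_def by (simp only: sum_distrib_left)
    then show ?thesis by simp
  qed
  also have "\<dots> \<le> 16 * (real R)\<^sup>2 * (2 / s)"
  proof (rule mult_left_mono)
    have "(\<Sum>i\<le>R. 1 / (s + real i)\<^sup>2) \<le> 2 / s - 1 / (s + real R)"
      by (rule sum_inverse_square_shift_le[OF s(1)])
    moreover have "1 / (s + real R) \<ge> 0" using s(1) by simp
    ultimately show "(\<Sum>i\<le>R. 1 / (s + real i)\<^sup>2) \<le> 2 / s" by linarith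
  qed simp
  also have "\<dots> = 32 * real R powr (3/2)"
  proof -
    have "real R powr (3/2) = real R powr (2 - 1/2)" by simp
    also have "\<dots> = (real R)\<^sup>2 / s"
      unfolding powr_diff s_def using R by (simp add: powr_half_sqrt)
    finally show ?thesis by simp
  qed
  finally show ?thesis .
qed

text \<open>Windows of relative width \<open>\<delta> = 1 / (2 * R)\<close> starting at
  \<open>\<beta> = j * \<delta>\<close> cover all divisors, and \<open>2 * \<delta>\<close> is the
  surplus \<open>1 / R\<close> assumed for \<open>q\<close>. The constant is
  \<open>5/4 * 32\<close>.\<close>

lemma card_cong_divisors_le:
  assumes n: "n \<ge> 2" and q: "q > 0" "coprime n q" and R: "R \<ge> (1::nat)"
    and large: "(1/4 + 1 / real R) * ln (real n) \<le> ln (real q)"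
    and S: "finite S" "\<And>x. x \<in> S \<Longrightarrow> x dvd n"
    and cong: "\<And>x y. x \<in> S \<Longrightarrow> y \<in> S \<Longrightarrow> [x = y] (mod q)"
  shows "real (card S) \<le> 40 * real R powr (3/2)"
proof -
  define \<delta> where "\<delta> = 1 / (2 * real R)"
  have \<delta>: "0 < \<delta>" "\<delta> \<le> 1" using R unfolding \<delta>_def by auto
  define N where "N = ln (real n)"
  have N: "N > 0" using n unfolding N_def by simp
  define W where "W = (\<lambda>j. {x\<in>S. real j * \<delta> * N \<le> ln (real x) \<and> ln (real x) \<le> (real j * \<delta> + \<delta>) * N})"
  have bound: "real (card (W j)) \<le> 5/4 * (1 / (1 / (2 * real R) + (real j / (2 * real R) - 1/2)\<^sup>2))" for j
  proof -
    have "real (card (W j)) * (\<delta> + (real j * \<delta> - 1/2)\<^sup>2) \<le> 5/4"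
      by (rule cong_divisors_window_card[OF n q _ _ _ \<delta>])
         (use S cong \<delta> large in \<open>auto simp: W_def N_def \<delta>_def\<close>)
    moreover have "\<delta> + (real j * \<delta> - 1/2)\<^sup>2 > 0" using \<delta> by (simp add: add_pos_nonneg)
    ultimately have "real (card (W j)) \<le> 5/4 / (\<delta> + (real j * \<delta> - 1/2)\<^sup>2)"
      by (rule mult_imp_le_div_pos[rotated])
    then show ?thesis by (simp add: \<delta>_def)
  qed
  have "S \<subseteq> (\<Union>j\<le>2 * R. W j)"
  proof
    fix x assume x: "x \<in> S"
    then have "x dvd n" using S(2) by blast
    then have x0: "x \<ge> 1" "x \<le> n" using n by (auto simp: Suc_le_eq intro!: Nat.gr0I dvd_imp_le)
    define t where "t = ln (real x) / (\<delta> * N)"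
    have t0: "t \<ge> 0" unfolding t_def using x0 \<delta> N by simp
    have lx: "ln (real x) = t * \<delta> * N" unfolding t_def using \<delta> N by simp
    have "ln (real x) \<le> N" unfolding N_def using x0 by simp
    then have "t * \<delta> \<le> 1" using lx N mult_right_le_imp_le[of "t * \<delta>" N 1] by simp
    then have "t \<le> 2 * real R" using R unfolding \<delta>_def by (simp add: field_simps)
    \<comment> \<open>The last index \<open>2 * R\<close> has to be included: it is attained at
      \<open>x = n\<close>.\<close>
    then have j: "nat \<lfloor>t\<rfloor> \<le> 2 * R" by linarith
    have fl: "real (nat \<lfloor>t\<rfloor>) \<le> t" "t \<le> real (nat \<lfloor>t\<rfloor>) + 1" using t0 by linarith+
    have "x \<in> W (nat \<lfloor>t\<rfloor>)"
      unfolding W_def lx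
    proof (intro CollectI conjI x)
      show "real (nat \<lfloor>t\<rfloor>) * \<delta> * N \<le> ln (real x)" unfolding lx
        using fl(1) \<delta> N by (intro mult_right_mono) auto
      have "t * (\<delta> * N) \<le> (real (nat \<lfloor>t\<rfloor>) + 1) * (\<delta> * N)"
        using fl(2) \<delta> N by (intro mult_right_mono) auto
      then show "ln (real x) \<le> (real (nat \<lfloor>t\<rfloor>) * \<delta> + \<delta>) * N" unfolding lx by (simp add: algebra_simps)
    qed
    then show "x \<in> (\<Union>j\<le>2 * R. W j)" using j by blast
  qed
  moreover have "finite (\<Union>j\<le>2 * R. W j)" using S(1) unfolding W_def by auto
  ultimately have "card S \<le> card (\<Union>j\<le>2 * R. W j)" by (rule card_mono[rotated])
  also have "\<dots> \<le> (\<Sum>j\<le>2 * R. card (W j))" by (rule card_UN_le) simp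
  finally have "real (card S) \<le> (\<Sum>j\<le>2 * R. real (card (W j)))" by (metis of_nat_le_iff of_nat_sum)
  also have "\<dots> \<le> (\<Sum>j\<le>2 * R. 5/4 * (1 / (1 / (2 * real R) + (real j / (2 * real R) - 1/2)\<^sup>2)))"
    by (intro sum_mono bound)
  also have "\<dots> \<le> 5/4 * (32 * real R powr (3/2))"
    unfolding sum_distrib_left[symmetric] by (intro mult_left_mono sum_window_bounds_le R) simp
  finally show ?thesis by simp
qed

lemma congruent_divisor_pairs_le_of_large_modulus:
  assumes n: "n > 0" and q: "q > 0" "coprime n q" and R: "R \<ge> (1::nat)"
    and large: "(1/4 + 1 / real R) * ln (real n) \<le> ln (real q)"
  shows "real (congruent_divisor_pairs n q) \<le> 40 * real R powr (3/2) * real (tau n)"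
proof -
  let ?V = "divisors n"
  have fin: "finite ?V" using n unfolding divisors_def by simp
  have c: "real (card {e\<in>?V. [d = e] (mod q)}) \<le> 40 * real R powr (3/2)" for d
  proof (cases "n \<ge> 2")
    case True
    show ?thesis
    proof (rule card_cong_divisors_le[OF True q R large])
      fix x y assume "x \<in> {e\<in>?V. [d = e] (mod q)}" "y \<in> {e\<in>?V. [d = e] (mod q)}"
      then have "[d = x] (mod q)" "[d = y] (mod q)" by auto
      then show "[x = y] (mod q)" by (simp add: cong_def)
    next
      show "finite {e\<in>?V. [d = e] (mod q)}" using fin by simp
    qed (simp add: divisors_def)
  next
    \<comment> \<open>The window bound divides by \<open>ln n\<close>; the value 1 is covered
      separately because the unitary divisor to which this bound is later applied may be 1.\<close>
    case False
    then have "n = 1" using n by simp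
    then have "{e\<in>?V. [d = e] (mod q)} \<subseteq> {1}" by (auto simp: divisors_def)
    then have "card {e\<in>?V. [d = e] (mod q)} \<le> 1" using card_mono[of "{1::nat}"] by fastforce
    moreover have "real R powr (3/2) \<ge> 1" using R by (simp add: ge_one_powr_ge_zero)
    ultimately show ?thesis by simp
  qed
  have "{(d, e). d \<in> ?V \<and> e \<in> ?V \<and> [d = e] (mod q)} = (SIGMA d:?V. {e\<in>?V. [d = e] (mod q)})" by auto
  then have "congruent_divisor_pairs n q = (\<Sum>d\<in>?V. card {e\<in>?V. [d = e] (mod q)})"
    unfolding congruent_divisor_pairs_def using fin by simp
  then have "real (congruent_divisor_pairs n q) \<le> (\<Sum>d\<in>?V. 40 * real R powr (3/2))"
    by (simp del: sum_constant add: sum_mono[OF c])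
  then show ?thesis by (simp add: tau_def mult.commute)
qed

section \<open>A unitary divisor of prescribed size\<close>

text \<open>Items of least value per weight are discarded until the rest fits into \<open>Y\<close>.
  The kept value is then at least the proportional share \<open>Y / sum w P\<close> of the total, up
  to the value, at most \<open>U\<close>, of the last item discarded.\<close>

lemma fractional_knapsack:
  fixes w u :: "'a \<Rightarrow> real"
  assumes "finite P" "\<And>p. p \<in> P \<Longrightarrow> w p > 0" "\<And>p. p \<in> P \<Longrightarrow> u p \<ge> 0" "\<And>p. p \<in> P \<Longrightarrow> u p \<le> U"
    and "0 \<le> Y" "Y \<le> sum w P"
  shows "\<exists>S\<subseteq>P. sum w S \<le> Y \<and> Y * sum u P \<le> (sum u S + U) * sum w P"
  using assms
proof (induction P rule: finite_psubset_induct)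
  case (psubset P)
  show ?case
  proof (cases "P = {}")
    case True
    then show ?thesis using psubset.prems by auto
  next
    case False
    \<comment> \<open>Discarding the item of least density does not decrease the overall density.\<close>
    define p where "p = arg_min_on (\<lambda>p. u p / w p) P"
    have p: "p \<in> P" unfolding p_def using False psubset.hyps by (simp add: arg_min_if_finite)
    have min: "u p / w p \<le> u r / w r" if "r \<in> P" for r
      unfolding p_def using psubset.hyps False that by (rule arg_min_least)
    have cross: "u p * w r \<le> w p * u r" if "r \<in> P" for r
      using min[OF that] psubset.prems(1)[OF p] psubset.prems(1)[OF that] by (simp add: field_simps)
    define W X W' X' where "W = sum w P" and "X = sum u P" and "W' = sum w (P - {p})" and "X' = sum u (P - {p})"
    have W: "W = w p + W'" and X: "X = u p + X'"
      unfolding W_def X_def W'_def X'_def using p psubset.hyps by (simp_all add: sum.remove)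
    have "u p * W \<le> w p * X"
      unfolding W_def X_def sum_distrib_left using cross by (rule sum_mono)
    then have ratio: "X * W' \<le> X' * W" unfolding W X by (simp add: algebra_simps)
    have wp: "w p > 0" and up: "u p \<ge> 0" "u p \<le> U" using psubset.prems p by auto
    have X0: "X \<ge> 0" unfolding X_def using psubset.prems(2) by (rule sum_nonneg)
    have YW: "Y \<le> W" and Y0: "Y \<ge> 0" using psubset.prems unfolding W_def by auto
    show ?thesis
    proof (cases "W' \<le> Y")
      case True
      \<comment> \<open>Here \<open>P - {p}\<close> already fits, and \<open>p\<close> is the one
        item charged to \<open>U\<close>.\<close>
      have "Y * X \<le> W * (X' + U)"
        using YW Y0 X0 X up(2) by (intro mult_mono) auto
      then show ?thesis using True unfolding W'_def X'_def W_def X_def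
        by (intro exI[of _ "P - {p}"]) (auto simp: mult.commute)
    next
      case False
      have "\<exists>S\<subseteq>P - {p}. sum w S \<le> Y \<and> Y * sum u (P - {p}) \<le> (sum u S + U) * sum w (P - {p})"
        using psubset.prems False p by (intro psubset.IH) (auto simp: W'_def)
      then obtain S where S: "S \<subseteq> P - {p}" "sum w S \<le> Y" "Y * X' \<le> (sum u S + U) * W'"
        unfolding W'_def X'_def by blast
      have "W' > 0" "W > 0" using False Y0 W wp by linarith+
      \<comment> \<open>The density comparison is chained with the induction hypothesis, and the
        positive factor \<open>W'\<close> is cancelled at the end.\<close>
      have "(Y * X) * W' \<le> (Y * X') * W"
        using mult_left_mono[OF ratio Y0] by (simp add: mult_ac)
      also have "\<dots> \<le> ((sum u S + U) * W') * W"
        using S(3) \<open>W > 0\<close> by (intro mult_right_mono) auto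
      finally have "(Y * X) * W' \<le> ((sum u S + U) * W) * W'" by (simp add: mult_ac)
      then have "Y * X \<le> (sum u S + U) * W" using \<open>W' > 0\<close> by simp
      then show ?thesis using S(1,2) unfolding W_def X_def by blast
    qed
  qed
qed

section \<open>Divisor counts of products of prime powers\<close>

lemma tau_prime_power:
  assumes "prime p"
  shows "tau (p ^ e) = e + 1"
proof -
  have "divisors (p ^ e) = (\<lambda>i. p ^ i) ` {..e}"
    using assms by (auto simp: divisors_def divides_primepow_nat prime_gt_0_nat)
  moreover have "inj_on (\<lambda>i. p ^ i) {..e}"
    using prime_gt_1_nat[OF assms] by (auto simp: inj_on_def)
  ultimately show ?thesis by (simp add: tau_def card_image)
qed

lemma coprime_prod_prime_powers:
  fixes e :: "nat \<Rightarrow> nat"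
  assumes "\<And>p. p \<in> S \<union> T \<Longrightarrow> prime p" "S \<inter> T = {}"
  shows "coprime (\<Prod>p\<in>S. p ^ e p) (\<Prod>p\<in>T. p ^ e p)"
proof (intro prod_coprime_left prod_coprime_right)
  fix p r assume "p \<in> S" "r \<in> T"
  then have "prime p" "prime r" "p \<noteq> r" using assms by auto
  then show "coprime (p ^ e p) (r ^ e r)" by (simp add: primes_coprime)
qed

lemma tau_prod_prime_powers:
  assumes "finite S" "\<And>p. p \<in> S \<Longrightarrow> prime p"
  shows "tau (\<Prod>p\<in>S. p ^ e p) = (\<Prod>p\<in>S. e p + 1)"
  using assms
proof (induction S rule: finite_induct)
  case empty
  have "divisors 1 = {1}" by (auto simp: divisors_def)
  then show ?case by (simp add: tau_def)
next
  case (insert p S)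
  have "coprime (\<Prod>p\<in>{p}. p ^ e p) (\<Prod>p\<in>S. p ^ e p)"
    using insert by (intro coprime_prod_prime_powers) auto
  moreover have "(\<Prod>p\<in>S. p ^ e p) > 0" "p ^ e p > 0"
    using insert.prems by (auto intro!: prod_pos simp: prime_gt_0_nat)
  ultimately have "tau (p ^ e p * (\<Prod>p\<in>S. p ^ e p)) = tau (p ^ e p) * tau (\<Prod>p\<in>S. p ^ e p)"
    by (intro tau_coprime_mult) auto
  then show ?case using insert by (simp add: tau_prime_power)
qed

lemma max_exponent_ge:
  "p \<in> prime_factors n \<Longrightarrow> multiplicity p n \<le> max_exponent n"
  unfolding max_exponent_def by (intro Max_ge) auto

lemma max_exponent_pos:
  assumes "n \<ge> 2"
  shows "max_exponent n \<ge> 1"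
proof -
  obtain p where "prime p" "p dvd n" using assms prime_factor_nat[of n] by auto
  then have "p \<in> prime_factors n" using assms by (simp add: prime_factors_dvd)
  moreover from this have "multiplicity p n > 0" by (simp add: prime_factors_multiplicity)
  ultimately show ?thesis using max_exponent_ge[of p n] by simp
qed

text \<open>The knapsack items are the prime powers exactly dividing \<open>n\<close>, with weight
  the logarithm of the prime power and value the logarithm of its number of divisors. Both add up
  over coprime products; \<open>m\<close> collects the chosen items and \<open>k\<close> the
  others.\<close>

lemma unitary_divisor_with_many_divisors:
  assumes n: "n \<ge> 2" and Y: "0 \<le> Y" "Y \<le> ln (real n)"
  shows "\<exists>m k. n = m * k \<and> coprime m k \<and> ln (real m) \<le> Y \<and>
    Y * ln (real (tau n)) \<le> (ln (real (tau m)) + ln (real (max_exponent n) + 1)) * ln (real n)"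
proof -
  define P e where "P = prime_factors n" and "e = (\<lambda>p. multiplicity p n)"
  define w u where "w = (\<lambda>p. ln (real (p ^ e p)))" and "u = (\<lambda>p. ln (real (e p + 1)))"
  have fin: "finite P" and pr: "\<And>p. p \<in> P \<Longrightarrow> prime p" unfolding P_def by auto
  have lnprod: "ln (real (\<Prod>p\<in>S. p ^ e p)) = sum w S" if "S \<subseteq> P" for S
    unfolding w_def of_nat_prod using fin that pr prime_gt_0_nat
    by (intro ln_prod) (auto simp: finite_subset subset_iff)
  have lntau: "ln (real (tau (\<Prod>p\<in>S. p ^ e p))) = sum u S" if "S \<subseteq> P" for S
  proof -
    have "tau (\<Prod>p\<in>S. p ^ e p) = (\<Prod>p\<in>S. e p + 1)"
      using fin that pr by (intro tau_prod_prime_powers) (auto simp: finite_subset)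
    then show ?thesis
      unfolding u_def using fin that by (simp only: of_nat_prod) (intro ln_prod, auto simp: finite_subset)
  qed
  have nprod: "n = (\<Prod>p\<in>P. p ^ e p)"
    unfolding P_def e_def using n by (intro prime_factorization_nat) auto
  have "\<exists>S\<subseteq>P. sum w S \<le> Y \<and> Y * sum u P \<le> (sum u S + ln (real (max_exponent n) + 1)) * sum w P"
  proof (rule fractional_knapsack[OF fin])
    fix p assume p: "p \<in> P"
    have "e p > 0" using p unfolding P_def e_def by (simp add: prime_factors_multiplicity)
    then have "p ^ e p > 1" using prime_gt_1_nat[OF pr[OF p]] by (intro one_less_power)
    then have "real 1 < real (p ^ e p)" by (simp only: of_nat_less_iff)
    then have "1 < real (p ^ e p)" by (simp only: of_nat_1)
    then show "w p > 0" unfolding w_def by (rule ln_gt_zero)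
    show "u p \<ge> 0" unfolding u_def by simp
    show "u p \<le> ln (real (max_exponent n) + 1)"
      using max_exponent_ge[of p n] p unfolding u_def e_def P_def by simp
  next
    show "Y \<le> sum w P" using Y(2) lnprod[of P] nprod by simp
  qed (use Y in auto)
  then obtain S where S: "S \<subseteq> P" "sum w S \<le> Y"
    "Y * sum u P \<le> (sum u S + ln (real (max_exponent n) + 1)) * sum w P" by blast
  let ?m = "\<Prod>p\<in>S. p ^ e p" and ?k = "\<Prod>p\<in>P - S. p ^ e p"
  have nmk: "n = ?m * ?k" using nprod prod.subset_diff[OF S(1) fin, of "\<lambda>p. p ^ e p"] by (simp add: mult.commute)
  have cop: "coprime ?m ?k" using S(1) pr by (intro coprime_prod_prime_powers) auto
  have "ln (real n) = sum w P" "ln (real (tau n)) = sum u P"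
    using lnprod[of P] lntau[of P] nprod by simp_all
  then have "Y * ln (real (tau n)) \<le> (ln (real (tau ?m)) + ln (real (max_exponent n) + 1)) * ln (real n)"
    using S(3) lntau[OF S(1)] by simp
  moreover have "ln (real ?m) \<le> Y" using lnprod[OF S(1)] S(2) by simp
  ultimately show ?thesis using nmk cop by blast
qed

section \<open>The upper bound\<close>

lemma tau_ge_2:
  assumes "n \<ge> 2"
  shows "tau n \<ge> 2"
proof -
  have "card {1, n} \<le> card (divisors n)"
    using assms by (intro card_mono finite_divisors) (auto simp: divisors_def)
  then show ?thesis using assms by (simp add: tau_def)
qed

lemma tau_pos: "n > 0 \<Longrightarrow> tau n > 0"
  unfolding tau_def using finite_divisors[of n] by (auto simp: card_gt_0_iff divisors_def)

lemma congruent_divisor_pairs_le: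
  assumes n: "n \<ge> 2" and q: "q \<ge> 2" and nq: "coprime n q"
    and \<eta>: "\<eta> = ln (real q) / ln (real n)"
  shows "real (congruent_divisor_pairs n q) \<le>
    (720 * exp 4) * (real (tau n) + real (tau n) powr (2 - 4 * \<eta>)) *
      real (max_exponent n) * ln (real (tau n)) powr (3/2)"
proof -
  define T L V where "T = real (tau n)" and "L = ln T" and "V = real (max_exponent n)"
  \<comment> \<open>This choice costs only a power of \<open>ln T\<close> in the bound for large
    moduli, while the excess \<open>1 / R\<close> over 1/4 costs only a bounded factor in
    \<open>T powr (4 * \<eta>)\<close>.\<close>
  define R where "R = nat \<lceil>L\<rceil>"
  define \<alpha> where "\<alpha> = 1/4 + 1 / real R"
  have T: "T \<ge> 2" unfolding T_def using tau_ge_2[OF n] by simp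
  have "ln 2 \<le> L" unfolding L_def using T by simp
  \<comment> \<open>This gives \<open>ln 2 \<ge> 1/2\<close>, so rounding \<open>L\<close> up stays
    below \<open>L + 1 \<le> 3 * L\<close>.\<close>
  moreover have "ln (1/2) \<le> 1/2 - (1::real)" by (rule ln_le_minus_one) simp
  ultimately have L: "1/2 \<le> L" by (simp add: ln_div)
  have V: "V \<ge> 1" unfolding V_def using max_exponent_pos[OF n] by simp
  have R: "R \<ge> 1" "L \<le> real R" "real R \<le> 3 * L" unfolding R_def using L by linarith+
  have lnn: "ln (real n) > 0" and lnq: "ln (real q) > 0" using n q by auto
  have \<alpha>: "\<alpha> > 0" unfolding \<alpha>_def using R by (simp add: add_pos_nonneg)
  have Rp: "real R powr (3/2) \<le> 9 * L powr (3/2)"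
  proof -
    have "real R powr (3/2) \<le> (3 * L) powr (3/2)" using R by (intro powr_mono2) auto
    also have "\<dots> = 3 powr (3/2) * L powr (3/2)" using L by (simp add: powr_mult)
    also have "\<dots> \<le> 3 powr 2 * L powr (3/2)" by (intro mult_right_mono powr_mono) auto
    finally show ?thesis by simp
  qed
  have "real (congruent_divisor_pairs n q) \<le> (720 * exp 4) * (T + T powr (2 - 4 * \<eta>)) * V * L powr (3/2)"
  proof (cases "\<alpha> * ln (real n) \<le> ln (real q)")
    case True
    have "real (congruent_divisor_pairs n q) \<le> 40 * real R powr (3/2) * T"
      unfolding T_def using congruent_divisor_pairs_le_of_large_modulus[OF _ _ nq R(1)] True n q
      by (simp add: \<alpha>_def)
    also have "\<dots> \<le> 40 * (9 * L powr (3/2)) * T"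
      using T Rp by (intro mult_right_mono mult_left_mono) auto
    also have "\<dots> = 360 * T * 1 * L powr (3/2)" by simp
    also have "\<dots> \<le> (720 * exp 4) * (T + T powr (2 - 4 * \<eta>)) * V * L powr (3/2)"
    proof (intro mult_right_mono mult_mono)
      have "1 \<le> exp (4::real)" by simp
      then show "360 \<le> 720 * exp (4::real)" by linarith
    qed (use T V in auto)
    finally show ?thesis .
  next
    case False
    \<comment> \<open>The largest value of \<open>ln m\<close> for which \<open>q\<close> still
      counts as a large modulus for \<open>m\<close>.\<close>
    define Y where "Y = ln (real q) / \<alpha>"
    have Y0: "Y \<ge> 0" unfolding Y_def using lnq \<alpha> by simp
    have Yn: "Y \<le> ln (real n)" unfolding Y_def using False \<alpha> by (simp add: field_simps)
    obtain m k where mk: "n = m * k" "coprime m k" "ln (real m) \<le> Y"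
      "Y * ln (real (tau n)) \<le> (ln (real (tau m)) + ln (V + 1)) * ln (real n)"
      using unitary_divisor_with_many_divisors[OF n Y0 Yn] unfolding V_def by blast
    have pos: "m > 0" "k > 0" using mk(1) n by (auto intro!: Nat.gr0I)
    define M K where "M = real (tau m)" and "K = real (tau k)"
    have M: "M > 0" and K: "K > 0" unfolding M_def K_def using tau_pos pos by auto
    have TMK: "T = M * K" unfolding T_def M_def K_def using tau_coprime_mult[OF mk(2) pos] mk(1) by simp
    have cm: "coprime m q" using nq mk(1) by simp
    have "\<alpha> * ln (real m) \<le> ln (real q)" using mk(3) \<alpha> unfolding Y_def by (simp add: field_simps)
    then have Hm: "real (congruent_divisor_pairs m q) \<le> 40 * real R powr (3/2) * M"
      unfolding M_def using congruent_divisor_pairs_le_of_large_modulus[OF pos(1) _ cm R(1)] q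
      by (simp add: \<alpha>_def)
    \<comment> \<open>The knapsack yields the exponent \<open>\<eta> / \<alpha>\<close> instead of
      \<open>4 * \<eta>\<close>. As \<open>4 * \<alpha> = 1 + 4 / R\<close>, the difference is
      \<open>\<eta> / \<alpha> * (4 / R)\<close>; with \<open>\<eta> / \<alpha> \<le> 1\<close> and
      \<open>L \<le> R\<close> its product with \<open>L\<close> is at most 4, the source of
      \<open>exp 4\<close>.\<close>
    have \<eta>4: "4 * \<eta> * L - 4 \<le> Y / ln (real n) * L"
    proof -
      have e: "Y / ln (real n) = \<eta> / \<alpha>" unfolding Y_def \<eta> by simp
      have \<eta>0: "\<eta> > 0" unfolding \<eta> using lnn lnq by simp
      have "\<eta> / \<alpha> \<le> 1" using Yn lnn unfolding e[symmetric] by simp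
      moreover have "L * (4 / real R) \<le> 4" using R L by (simp add: field_simps)
      ultimately have "\<eta> / \<alpha> * (L * (4 / real R)) \<le> 1 * 4"
        using \<eta>0 \<alpha> L R by (intro mult_mono) auto
      moreover have "\<eta> / \<alpha> * (4 / real R) = 4 * \<eta> - \<eta> / \<alpha>"
      proof -
        have r: "4 / real R = 4 * \<alpha> - 1" unfolding \<alpha>_def by simp
        show ?thesis unfolding r using \<alpha> by (simp add: field_simps)
      qed
      moreover have "\<eta> / \<alpha> * (L * (4 / real R)) = \<eta> / \<alpha> * (4 / real R) * L" by simp
      ultimately have "(4 * \<eta> - \<eta> / \<alpha>) * L \<le> 4" by (simp only: mult_1)
      then show ?thesis unfolding e by (simp add: algebra_simps)
    qed
    have "Y / ln (real n) * L \<le> ln M + ln (V + 1)"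
      using mk(4) lnn unfolding L_def T_def M_def by (simp add: field_simps)
    also have "\<dots> = ln (M * (V + 1))" using M V by (simp add: ln_mult)
    also have "\<dots> \<le> ln (M * (2 * V))" using M V by simp
    finally have "4 * \<eta> * L - 4 \<le> ln (M * (2 * V))" using \<eta>4 by linarith
    then have "exp (4 * \<eta> * L - 4) \<le> M * (2 * V)" using M V by (simp add: ln_ge_iff)
    then have key: "T powr (4 * \<eta>) \<le> 2 * exp 4 * V * M"
      using T by (simp add: powr_def L_def exp_diff field_simps)
    have "real (congruent_divisor_pairs n q) \<le> K\<^sup>2 * real (congruent_divisor_pairs m q)"
      unfolding K_def mk(1)
      using congruent_divisor_pairs_coprime_mult_le[OF mk(2) pos q] nq mk(1) by simp
    also have "\<dots> \<le> K\<^sup>2 * (40 * real R powr (3/2) * M)" using Hm by (intro mult_left_mono) auto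
    also have "\<dots> \<le> K\<^sup>2 * (40 * (9 * L powr (3/2)) * M)"
      using Rp M by (intro mult_left_mono mult_right_mono) auto
    also have "\<dots> = 360 * L powr (3/2) * (K\<^sup>2 * M)" by simp
    also have "\<dots> \<le> 360 * L powr (3/2) * (2 * exp 4 * V * T powr (2 - 4 * \<eta>))"
    proof (intro mult_left_mono)
      \<comment> \<open>Since \<open>T = M * K\<close>, the quantity bounded here is
        \<open>T^2 / M\<close>, and \<open>key\<close> is the lower bound for \<open>M\<close>. The
        factor 2 from \<open>V + 1 \<le> 2 * V\<close> turns \<open>40 * 9\<close> into 720.\<close>
      have "K\<^sup>2 * M * T powr (4 * \<eta>) \<le> K\<^sup>2 * M * (2 * exp 4 * V * M)"
        using key M by (intro mult_left_mono) auto
      also have "\<dots> = 2 * exp 4 * V * T\<^sup>2" unfolding TMK by (simp add: power2_eq_square)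
      also have "T\<^sup>2 = T powr (2 - 4 * \<eta>) * T powr (4 * \<eta>)"
        using T by (simp flip: powr_add)
      finally have "K\<^sup>2 * M * T powr (4 * \<eta>) \<le> (2 * exp 4 * V * T powr (2 - 4 * \<eta>)) * T powr (4 * \<eta>)"
        by (simp add: mult_ac)
      moreover have "T powr (4 * \<eta>) > 0" using T by simp
      ultimately show "K\<^sup>2 * M \<le> 2 * exp 4 * V * T powr (2 - 4 * \<eta>)"
        by (rule mult_right_le_imp_le)
    qed simp
    also have "\<dots> = (720 * exp 4) * T powr (2 - 4 * \<eta>) * V * L powr (3/2)" by simp
    also have "\<dots> \<le> (720 * exp 4) * (T + T powr (2 - 4 * \<eta>)) * V * L powr (3/2)"
      using T V by (intro mult_right_mono mult_left_mono) auto
    finally show ?thesis .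
  qed
  then show ?thesis unfolding T_def V_def L_def by simp
qed

theorem theorem4:
  shows "(\<forall>n q :: nat. n \<ge> 2 \<and> q \<ge> 2 \<and> coprime n q \<longrightarrow>
            real (congruent_divisor_pairs n q) =
              1 / real (totient q) *
              (\<Sum>\<chi>\<in>dirichlet_characters q. (cmod (\<Sum>d\<in>divisors n. \<chi> d))\<^sup>2)) \<and>
         (\<exists>C :: real. C > 0 \<and>
            (\<forall>n q :: nat. n \<ge> 2 \<and> q \<ge> 2 \<and> coprime n q \<longrightarrow>
              (let \<eta> = ln (real q) / ln (real n) in
                real (congruent_divisor_pairs n q) \<le>
                  C * (real (tau n) + real (tau n) powr (2 - 4 * \<eta>)) *
                    real (max_exponent n) * ln (real (tau n)) powr (3 / 2))))"
proof (intro conjI exI[of _ "720 * exp 4"] allI impI)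
  fix n q :: nat
  assume "n \<ge> 2 \<and> q \<ge> 2 \<and> coprime n q"
  then show "real (congruent_divisor_pairs n q) =
      1 / real (totient q) * (\<Sum>\<chi>\<in>dirichlet_characters q. (cmod (\<Sum>d\<in>divisors n. \<chi> d))\<^sup>2)"
    by (intro congruent_divisor_pairs_eq_character_sum) auto
next
  fix n q :: nat
  assume "n \<ge> 2 \<and> q \<ge> 2 \<and> coprime n q"
  then show "let \<eta> = ln (real q) / ln (real n) in
      real (congruent_divisor_pairs n q) \<le>
        (720 * exp 4) * (real (tau n) + real (tau n) powr (2 - 4 * \<eta>)) *
          real (max_exponent n) * ln (real (tau n)) powr (3 / 2)"
    unfolding Let_def by (intro congruent_divisor_pairs_le[OF _ _ _ refl]) auto
qed simp

end
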